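(* Let $n$ be a positive integer, $P_n$ the path graph on $[n]=\{1,\ldots,n\}$, and let $J_{P_n}\subset T$ be the defining ideal of the Rees algebra of the vertex cover ideal of $P_n$, with $T$, the generators $u_1,\ldots,u_s$, and the lexicographic order $<_{\rm lex}$ on $T$ as defined in the context. Let $\mathcal A_n$ be the set of those monomials $x_{i+1}y_j$, $1\le i<n$, $1\le j\le s$, for which $x_{i-1}x_i$ divides $x_0u_j$. Let $\mathcal B_n$ be the set of those monomials $y_jy_k$ with $j<k$ satisfying one of the following conditions: - there is $3\le i\le n-1$ for which $x_{i-1}x_i$ divides $u_j$, neither $x_{i-2}$ nor $x_i$ divides $u_k$, and $\operatorname{supp}(u_j)\cap[i-3]\ne\operatorname{supp}(u_k)\cap[i-3]$; - there is $3\le i\le n-2$ for which $x_ix_{i+1}$ divides $u_j$, and $x_{i-1}x_i$ divides $u_k$; - there is $3\le i\le n-2$ for which $x_{i-1}x_i$ divides $u_j$, and $x_ix_{i+1}$ divides $u_k$. Then the minimal set of monomial generators of the initial ideal $\operatorname{in}_{<_{\rm lex}}(J_{P_n})$ of $J_{P_n}$ with respect to $<_{\rm lex}$ is equal to $\mathcal A_n\cup\mathcal B_n$. In particular, $\operatorname{in}_{<_{\rm lex}}(J_{P_n})$ is generated by quadratic monomials.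
   Context: $P_n$ is the graph with vertex set $[n]$ and edge set $\{\{1,2\},\{2,3\},\ldots,\{n-1,n\}\}$. Let $K$ be a field, $S=K[x_1,\ldots,x_n]$, with the pure lexicographic order induced by $x_1>x_2>\cdots>x_n$. The vertex cover ideal $I_{P_n}\subset S$ is generated by the monomials $\prod_{i\in C}x_i$, where $C$ ranges over the minimal vertex covers of $P_n$; let $u_1,\ldots,u_s$ be its minimal monomial generators, labeled so that $u_s<_{\rm lex}\cdots<_{\rm lex}u_2<_{\rm lex}u_1$. The Rees algebra is $\mathcal R(I_{P_n})=K[x_1,\ldots,x_n,u_1t,\ldots,u_st]\subset S[t]$. Let $T=K[x_1,\ldots,x_n,y_1,\ldots,y_s]$ and let $\pi:T\to\mathcal R(I_{P_n})$ be the $K$-algebra homomorphism with $\pi(x_i)=x_i$, $\pi(y_j)=u_jt$; $J_{P_n}=\operatorname{Ker}\pi$. On $T$ consider the pure lexicographic order $<_{\rm lex}$ induced by $y_1>y_2>\cdots>y_s>x_1>x_2>\cdots>x_n$. For a monomial $u\in S$, $\operatorname{supp}(u)=\{i: x_i\mid u\}$; $[0]=\emptyset$. Here $x_0$ is an auxiliary extra variable, so for $i=1$ the condition "$x_{i-1}x_i$ divides $x_0u_j$" means $x_1\mid u_j$, and for $i\ge2$ it means $x_{i-1}x_i\mid u_j$. *)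

theory Defs
  imports "HOL-Algebra.RingHom" "HOL-Algebra.Generated_Rings" "HOL-Library.Poly_Mapping"
begin

text \<open>
  Vertex covers of a simple graph with vertex set \<open>V\<close>, whose edges are two-element
  subsets of \<open>V\<close>.
\<close>

definition vertex_cover :: "nat set \<Rightarrow> nat set set \<Rightarrow> nat set \<Rightarrow> bool" where
  "vertex_cover V E C \<longleftrightarrow> C \<subseteq> V \<and> (\<forall>e\<in>E. e \<inter> C \<noteq> {})"

definition minimal_vertex_cover :: "nat set \<Rightarrow> nat set set \<Rightarrow> nat set \<Rightarrow> bool" where
  "minimal_vertex_cover V E C \<longleftrightarrow>
     vertex_cover V E C \<and> (\<forall>D. D \<subset> C \<longrightarrow> \<not> vertex_cover V E D)"

definition path_edges :: "nat \<Rightarrow> nat set set" where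
  "path_edges n = {{i, i + 1} | i. 1 \<le> i \<and> i < n}"


text \<open>
  All polynomial rings involved live inside one ambient ring: a monomial is its exponent
  vector, a finitely supported map from variables to \<open>nat\<close>, and a polynomial a finitely
  supported map from monomials to coefficients. The product of two monomials is therefore the
  sum of exponent vectors, and \<open>0\<close> is the monomial \<open>1\<close>. The rings \<open>S\<close>, \<open>S[t]\<close> and \<open>T\<close> are
  the subrings of polynomials in a given set of variables.
\<close>

datatype var = XVar nat | YVar nat | TVar

type_synonym monom = "var \<Rightarrow>\<^sub>0 nat"

type_synonym 'k mpoly = "monom \<Rightarrow>\<^sub>0 'k"

abbreviation x_mon :: "nat \<Rightarrow> monom" where
  "x_mon i \<equiv> Poly_Mapping.single (XVar i) 1"

abbreviation y_mon :: "nat \<Rightarrow> monom" where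
  "y_mon j \<equiv> Poly_Mapping.single (YVar j) 1"

abbreviation t_mon :: monom where
  "t_mon \<equiv> Poly_Mapping.single TVar 1"

definition mon_dvd :: "monom \<Rightarrow> monom \<Rightarrow> bool" (infix \<open>dvd\<^sub>m\<close> 50) where
  "m dvd\<^sub>m m' \<longleftrightarrow> (\<exists>q. m' = m + q)"

definition mon_degree :: "monom \<Rightarrow> nat" where
  "mon_degree m = (\<Sum>v\<in>Poly_Mapping.keys m. Poly_Mapping.lookup m v)"

definition supp :: "monom \<Rightarrow> nat set" where
  "supp u = {i. x_mon i dvd\<^sub>m u}"

definition poly_of_mon :: "monom \<Rightarrow> 'k::comm_ring_1 mpoly" where
  "poly_of_mon m = Poly_Mapping.single m 1"

definition const_poly :: "'k \<Rightarrow> 'k::comm_ring_1 mpoly" where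
  "const_poly c = Poly_Mapping.single 0 c"

definition monomials :: "var set \<Rightarrow> monom set" where
  "monomials V = {m. Poly_Mapping.keys m \<subseteq> V}"

definition poly_ring :: "var set \<Rightarrow> 'k::comm_ring_1 mpoly ring" where
  "poly_ring V =
     \<lparr>carrier = {p. Poly_Mapping.keys p \<subseteq> monomials V}, mult = (*), one = 1, zero = 0, add = (+)\<rparr>"

text \<open>
  Without this fact \<^const>\<open>genideal\<close> would be meaningless on \<^const>\<open>poly_ring\<close>: it is the
  intersection of all sets satisfying \<^const>\<open>ideal\<close>, which presupposes a ring.
\<close>

lemma cring_poly_ring: "cring (poly_ring V :: 'k::comm_ring_1 mpoly ring)"
proof -
  have mult: "Poly_Mapping.keys (p * q) \<subseteq> monomials V"
    if "Poly_Mapping.keys p \<subseteq> monomials V" "Poly_Mapping.keys q \<subseteq> monomials V" for p q :: "'k mpoly"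
  proof
    fix m assume "m \<in> Poly_Mapping.keys (p * q)"
    then obtain a b where "a \<in> Poly_Mapping.keys p" "b \<in> Poly_Mapping.keys q" "m = a + b"
      using keys_mult[of p q] by blast
    then show "m \<in> monomials V"
      using that keys_add[of a b] unfolding monomials_def by blast
  qed
  have add: "Poly_Mapping.keys (p + q) \<subseteq> monomials V"
    if "Poly_Mapping.keys p \<subseteq> monomials V" "Poly_Mapping.keys q \<subseteq> monomials V" for p q :: "'k mpoly"
    using that keys_add[of p q] by blast
  have inv: "\<exists>q. Poly_Mapping.keys q \<subseteq> monomials V \<and> q + p = 0"
    if "Poly_Mapping.keys p \<subseteq> monomials V" for p :: "'k mpoly"
  proof (intro exI conjI)
    show "Poly_Mapping.keys (- p) \<subseteq> monomials V"
      using that by (auto simp: in_keys_iff)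
  qed simp
  have one: "Poly_Mapping.keys (1 :: 'k mpoly) \<subseteq> monomials V"
    by (auto simp: monomials_def)
  show ?thesis
    by (rule cringI; (rule abelian_groupI comm_monoidI)?;
        use mult add inv one in \<open>auto simp: poly_ring_def algebra_simps\<close>)
qed

definition is_minimal_monomial_generators ::
    "var set \<Rightarrow> 'k::comm_ring_1 mpoly set \<Rightarrow> monom set \<Rightarrow> bool" where
  "is_minimal_monomial_generators V I G \<longleftrightarrow>
     G \<subseteq> monomials V \<and>
     Idl\<^bsub>poly_ring V\<^esub> (poly_of_mon ` G) = I \<and>
     (\<forall>H. H \<subset> G \<longrightarrow> Idl\<^bsub>poly_ring V\<^esub> (poly_of_mon ` H) \<noteq> I)"


text \<open>
  The pure lexicographic order for $y_1 > y_2 > \ldots > x_1 > x_2 > \ldots$; on monomials in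
  the \<open>x\<close> variables alone it is the order used on \<open>S\<close>. The position of \<^const>\<open>TVar\<close> is
  immaterial, since monomials involving it are never compared.
\<close>

fun var_gt :: "var \<Rightarrow> var \<Rightarrow> bool" where
  "var_gt (XVar i) (XVar j) \<longleftrightarrow> i < j"
| "var_gt (YVar i) (YVar j) \<longleftrightarrow> i < j"
| "var_gt (YVar _) (XVar _) \<longleftrightarrow> True"
| "var_gt (XVar _) (YVar _) \<longleftrightarrow> False"
| "var_gt TVar v \<longleftrightarrow> v \<noteq> TVar"
| "var_gt _ TVar \<longleftrightarrow> False"

definition lex_less :: "monom \<Rightarrow> monom \<Rightarrow> bool" (infix \<open><\<^sub>l\<^sub>e\<^sub>x\<close> 50) where
  "m <\<^sub>l\<^sub>e\<^sub>x m' \<longleftrightarrow>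
     (\<exists>v. Poly_Mapping.lookup m v < Poly_Mapping.lookup m' v \<and>
          (\<forall>w. var_gt w v \<longrightarrow> Poly_Mapping.lookup m w = Poly_Mapping.lookup m' w))"

definition is_initial_monomial :: "'k::comm_ring_1 mpoly \<Rightarrow> monom \<Rightarrow> bool" where
  "is_initial_monomial p m \<longleftrightarrow>
     m \<in> Poly_Mapping.keys p \<and> (\<forall>m'\<in>Poly_Mapping.keys p. m' = m \<or> m' <\<^sub>l\<^sub>e\<^sub>x m)"

definition initial_ideal :: "var set \<Rightarrow> 'k::comm_ring_1 mpoly set \<Rightarrow> 'k mpoly set" where
  "initial_ideal V I =
     Idl\<^bsub>poly_ring V\<^esub> {poly_of_mon m | m. \<exists>p\<in>I. is_initial_monomial p m}"


definition S_vars :: "nat \<Rightarrow> var set" where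
  "S_vars n = XVar ` {1..n}"

definition T_vars :: "nat \<Rightarrow> nat \<Rightarrow> var set" where
  "T_vars n s = XVar ` {1..n} \<union> YVar ` {1..s}"

definition vertex_cover_ideal :: "nat \<Rightarrow> 'k::field mpoly set" where
  "vertex_cover_ideal n =
     Idl\<^bsub>poly_ring (S_vars n)\<^esub>
       {poly_of_mon (\<Sum>i\<in>C. x_mon i) | C. minimal_vertex_cover {1..n} (path_edges n) C}"

text \<open>The algebra $K[x_1,\ldots,x_n,u_1t,\ldots,u_st]$, a subring of $S[t]$.\<close>

definition rees_algebra :: "nat \<Rightarrow> nat \<Rightarrow> (nat \<Rightarrow> monom) \<Rightarrow> 'k::field mpoly ring" where
  "rees_algebra n s u =
     (let R = poly_ring (insert TVar (S_vars n)) in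
      R\<lparr>carrier := generate_ring R
          (range const_poly
           \<union> (\<lambda>i. poly_of_mon (x_mon i)) ` {1..n}
           \<union> (\<lambda>j. poly_of_mon (u j + t_mon)) ` {1..s})\<rparr>)"

definition substitute ::
    "(var \<Rightarrow> 'k::comm_ring_1 mpoly) \<Rightarrow> 'k mpoly \<Rightarrow> 'k mpoly" where
  "substitute f p =
     (\<Sum>m\<in>Poly_Mapping.keys p. const_poly (Poly_Mapping.lookup p m) *
        (\<Prod>v\<in>Poly_Mapping.keys m. f v ^ Poly_Mapping.lookup m v))"

text \<open>The value at \<^const>\<open>TVar\<close> is immaterial, as this variable does not occur in \<open>T\<close>.\<close>

fun rees_image :: "(nat \<Rightarrow> monom) \<Rightarrow> var \<Rightarrow> 'k::field mpoly" where
  "rees_image u (XVar i) = poly_of_mon (x_mon i)"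
| "rees_image u (YVar j) = poly_of_mon (u j + t_mon)"
| "rees_image u TVar = poly_of_mon t_mon"

definition rees_map :: "(nat \<Rightarrow> monom) \<Rightarrow> 'k::field mpoly \<Rightarrow> 'k mpoly" where
  "rees_map u = substitute (rees_image u)"

definition rees_ideal :: "nat \<Rightarrow> nat \<Rightarrow> (nat \<Rightarrow> monom) \<Rightarrow> 'k::field mpoly set" where
  "rees_ideal n s u =
     a_kernel (poly_ring (T_vars n s)) (rees_algebra n s u) (rees_map u)"


text \<open>
  In the next definition, \<open>x_mon 0\<close> is the auxiliary variable $x_0$; it is not a variable of
  \<open>S\<close> or \<open>T\<close>.
\<close>

definition A_set :: "nat \<Rightarrow> nat \<Rightarrow> (nat \<Rightarrow> monom) \<Rightarrow> monom set" where
  "A_set n s u =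
     {x_mon (i + 1) + y_mon j | i j.
        1 \<le> i \<and> i < n \<and> 1 \<le> j \<and> j \<le> s \<and>
        (x_mon (i - 1) + x_mon i) dvd\<^sub>m (x_mon 0 + u j)}"

definition B_set :: "nat \<Rightarrow> nat \<Rightarrow> (nat \<Rightarrow> monom) \<Rightarrow> monom set" where
  "B_set n s u =
     {y_mon j + y_mon k | j k.
        1 \<le> j \<and> j < k \<and> k \<le> s \<and>
        ((\<exists>i. 3 \<le> i \<and> i \<le> n - 1 \<and>
              (x_mon (i - 1) + x_mon i) dvd\<^sub>m u j \<and>
              \<not> x_mon (i - 2) dvd\<^sub>m u k \<and> \<not> x_mon i dvd\<^sub>m u k \<and>
              supp (u j) \<inter> {1..i - 3} \<noteq> supp (u k) \<inter> {1..i - 3}) \<or>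
         (\<exists>i. 3 \<le> i \<and> i \<le> n - 2 \<and>
              (x_mon i + x_mon (i + 1)) dvd\<^sub>m u j \<and>
              (x_mon (i - 1) + x_mon i) dvd\<^sub>m u k) \<or>
         (\<exists>i. 3 \<le> i \<and> i \<le> n - 2 \<and>
              (x_mon (i - 1) + x_mon i) dvd\<^sub>m u j \<and>
              (x_mon i + x_mon (i + 1)) dvd\<^sub>m u k))}"

end

theory Submission
  imports Defs
begin

text \<open>
  The map \<open>\<pi>\<close> sends monomials to monomials, so its kernel \<open>J\<close> is spanned by differences of monomials
  with the same image. A monomial is therefore an initial monomial of \<open>J\<close> exactly when it is not the
  lexicographically smallest monomial in its fibre (\<open>rees_initial_monomial_iff\<close>). Call a monomial
  standard if no element of \<open>\<A>\<^sub>n \<union> \<B>\<^sub>n\<close> divides it. Two facts suffice: every element of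
  \<open>\<A>\<^sub>n \<union> \<B>\<^sub>n\<close> has a smaller monomial in its fibre, and no fibre contains two standard monomials.
  Fibres are finite, and by the first fact their smallest element is standard; by the second fact it
  is the only standard element, so every other monomial of the fibre is divisible by an element of
  \<open>\<A>\<^sub>n \<union> \<B>\<^sub>n\<close>. All these elements have degree two, so none divides another, and they are the minimal
  generators.

  The first fact (\<open>AB_set_reduces\<close>) comes from moving vertices between covers. For
  \<open>x\<^sub>i\<^sub>+\<^sub>1 y\<^sub>j \<in> \<A>\<^sub>n\<close> the vertex \<open>i\<close> of the cover is replaced by \<open>i + 1\<close>. For \<open>y\<^sub>j y\<^sub>k \<in> \<B>\<^sub>n\<close> the
  two covers exchange their parts beyond a suitable place. If the resulting covers are not minimal,
  vertices are dropped and appear as \<open>x\<close> variables.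

  For the second fact (\<open>standard_unique\<close>), let \<open>w\<close> and \<open>w'\<close> be standard with the same image, so that
  both have the same number \<open>d\<close> of factors \<open>y\<close>, and let \<open>c\<^sub>i\<close> be the number of covers of \<open>w\<close> that
  contain \<open>i\<close>, with \<open>c\<^sub>0 = d\<close>. Each edge is covered, so \<open>c\<^sub>i\<^sub>-\<^sub>1 + c\<^sub>i - d\<close> covers contain both
  \<open>i - 1\<close> and \<open>i\<close>, where \<open>0\<close> counts as a vertex of every cover. Suppose the numbers for \<open>w\<close> and
  \<open>w'\<close> differ, for the first time at \<open>i\<close>, and \<open>c\<^sub>i\<close> is the larger one. Then some cover of \<open>w\<close>
  contains \<open>i - 1\<close> and \<open>i\<close>, so \<open>x\<^sub>i\<^sub>+\<^sub>1\<close> does not divide \<open>w\<close> because of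
  \<open>\<A>\<^sub>n\<close>. Hence \<open>c\<^sub>i\<^sub>+\<^sub>1\<close> is as large as it can be with this image, and some cover of \<open>w\<close> contains
  \<open>i\<close> and \<open>i + 1\<close>. The last two conditions in \<open>\<B>\<^sub>n\<close> exclude this pair. So \<open>w\<close> and \<open>w'\<close> have the
  same \<open>c\<^sub>i\<close> (\<open>cover_count_determined\<close>), and then the same \<open>x\<close> exponents.

  It remains to see that the \<open>c\<^sub>i\<close> determine the covers. A cover read from left to right has a
  choice at \<open>i + 1 > 1\<close> only if it contains \<open>i\<close> but not \<open>i - 1\<close>. By the first condition in \<open>\<B>\<^sub>n\<close>, among
  the covers with a choice those with the lexicographically smallest prefixes are continued by
  \<open>i + 1\<close>, and their number is prescribed by \<open>c\<^sub>i\<^sub>+\<^sub>1\<close>. So the multiset of prefixes of length \<open>i\<close>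
  determines that of length \<open>i + 1\<close> (\<open>prefix_count_determined\<close>).
\<close>

section \<open>Divisibility of monomials and monomial ideals\<close>

lemma mon_dvd_iff_lookup_le:
  "m dvd\<^sub>m m' \<longleftrightarrow> (\<forall>v. Poly_Mapping.lookup m v \<le> Poly_Mapping.lookup m' v)"
proof
  assume "m dvd\<^sub>m m'"
  then show "\<forall>v. Poly_Mapping.lookup m v \<le> Poly_Mapping.lookup m' v"
    by (auto simp: mon_dvd_def lookup_add)
next
  assume "\<forall>v. Poly_Mapping.lookup m v \<le> Poly_Mapping.lookup m' v"
  then have "m' = m + (m' - m)"
    by (intro poly_mapping_eqI) (simp add: lookup_add lookup_minus)
  then show "m dvd\<^sub>m m'"
    unfolding mon_dvd_def by blast
qed

lemma mon_dvd_refl: "m dvd\<^sub>m m"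
  by (simp add: mon_dvd_iff_lookup_le)

lemma mon_dvd_trans: "a dvd\<^sub>m b \<Longrightarrow> b dvd\<^sub>m c \<Longrightarrow> a dvd\<^sub>m c"
  unfolding mon_dvd_iff_lookup_le using le_trans by blast

lemma mon_dvd_antisym: "a dvd\<^sub>m b \<Longrightarrow> b dvd\<^sub>m a \<Longrightarrow> a = b"
  unfolding mon_dvd_iff_lookup_le by (simp add: poly_mapping_eqI dual_order.antisym)

lemma monomials_add_iff: "a + b \<in> monomials V \<longleftrightarrow> a \<in> monomials V \<and> b \<in> monomials V"
proof -
  have "Poly_Mapping.keys (a + b) = Poly_Mapping.keys a \<union> Poly_Mapping.keys b"
    by (auto simp: in_keys_iff lookup_add)
  then show ?thesis
    by (simp add: monomials_def)
qed

lemma zero_in_monomials: "0 \<in> monomials V"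
  by (simp add: monomials_def)

lemma monomials_sumI: "(\<And>i. i \<in> I \<Longrightarrow> f i \<in> monomials V) \<Longrightarrow> sum f I \<in> monomials V"
  by (induction I rule: infinite_finite_induct) (auto simp: monomials_add_iff zero_in_monomials)

lemma single_in_monomials: "v \<in> V \<Longrightarrow> Poly_Mapping.single v k \<in> monomials V"
  by (auto simp: monomials_def)

lemma mon_degree_add: "mon_degree (a + b) = mon_degree a + mon_degree b"
proof -
  have deg: "mon_degree m = (\<Sum>v\<in>Poly_Mapping.keys a \<union> Poly_Mapping.keys b. Poly_Mapping.lookup m v)"
    if "Poly_Mapping.keys m \<subseteq> Poly_Mapping.keys a \<union> Poly_Mapping.keys b" for m
    unfolding mon_degree_def by (rule sum.mono_neutral_left) (use that in \<open>auto simp: in_keys_iff\<close>)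
  show ?thesis
    using deg[of a] deg[of b] deg[of "a + b"] keys_add[of a b]
    by (simp add: lookup_add sum.distrib)
qed

lemma mon_degree_eq_0_iff: "mon_degree m = 0 \<longleftrightarrow> m = 0"
  by (auto simp: mon_degree_def in_keys_iff intro: poly_mapping_eqI)

lemma mon_degree_single: "mon_degree (Poly_Mapping.single v k) = k"
  by (simp add: mon_degree_def)

lemma mon_dvd_same_degree_imp_eq: "a dvd\<^sub>m b \<Longrightarrow> mon_degree a = mon_degree b \<Longrightarrow> a = b"
  unfolding mon_dvd_def by (auto simp: mon_degree_add mon_degree_eq_0_iff)

lemma keys_poly_of_mon: "Poly_Mapping.keys (poly_of_mon m :: 'k::comm_ring_1 mpoly) = {m}"
  by (simp add: poly_of_mon_def)

lemma poly_eq_sum_of_terms: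
  "p = (\<Sum>m\<in>Poly_Mapping.keys p. Poly_Mapping.single m (Poly_Mapping.lookup p m))"
  by (rule poly_mapping_eqI) (auto simp: lookup_sum lookup_single when_def in_keys_iff)

text \<open>
  The polynomials all of whose monomials lie above some member of \<open>G\<close> form an ideal, because the
  monomials of a product are products of monomials; and each of their terms is a term times a
  generator.
\<close>

lemma Idl_of_monomials:
  assumes G: "G \<subseteq> monomials V"
  shows "Idl\<^bsub>poly_ring V\<^esub> (poly_of_mon ` G :: 'k::comm_ring_1 mpoly set) =
    {p. Poly_Mapping.keys p \<subseteq> monomials V \<and> (\<forall>m\<in>Poly_Mapping.keys p. \<exists>g\<in>G. g dvd\<^sub>m m)}"
    (is "?I = ?M")
proof
  interpret cring "poly_ring V :: 'k mpoly ring"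
    by (rule cring_poly_ring)
  have gens: "(poly_of_mon ` G :: 'k mpoly set) \<subseteq> carrier (poly_ring V)"
    using G by (auto simp: poly_ring_def keys_poly_of_mon)
  have mult: "x * a \<in> ?M" if "a \<in> ?M" "x \<in> carrier (poly_ring V)" for x a :: "'k mpoly"
  proof -
    have "x * a \<in> carrier (poly_ring V)"
      using that m_closed[of x a] by (simp add: poly_ring_def)
    moreover have "\<exists>g\<in>G. g dvd\<^sub>m m" if "m \<in> Poly_Mapping.keys (x * a)" for m
    proof -
      obtain b c where "m = b + c" "c \<in> Poly_Mapping.keys a"
        using keys_mult[of x a] \<open>m \<in> Poly_Mapping.keys (x * a)\<close> by blast
      moreover from this obtain g where "g \<in> G" "g dvd\<^sub>m c"
        using \<open>a \<in> ?M\<close> by blast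
      ultimately show ?thesis
        by (metis mon_dvd_def mon_dvd_trans add.commute)
    qed
    ultimately show ?thesis
      by (simp add: poly_ring_def)
  qed
  have a_inv: "\<ominus>\<^bsub>poly_ring V\<^esub> a = - a" if "a \<in> carrier (poly_ring V)" for a :: "'k mpoly"
    by (rule minus_equality) (use that in \<open>auto simp: poly_ring_def in_keys_iff\<close>)
  have "ideal ?M (poly_ring V :: 'k mpoly ring)"
  proof (rule idealI)
    show "subgroup ?M (add_monoid (poly_ring V :: 'k mpoly ring))"
    proof (rule add.subgroupI)
      show "?M \<subseteq> carrier (poly_ring V)"
        by (auto simp: poly_ring_def)
      have "(0 :: 'k mpoly) \<in> ?M" by simp
      then show "?M \<noteq> {}" by blast
      show "\<ominus>\<^bsub>poly_ring V\<^esub> a \<in> ?M" if "a \<in> ?M" for a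
      proof -
        have "Poly_Mapping.keys (- a) = Poly_Mapping.keys a"
          by (auto simp: in_keys_iff)
        then show ?thesis
          using that a_inv[of a] by (simp add: poly_ring_def)
      qed
      show "a \<oplus>\<^bsub>poly_ring V\<^esub> b \<in> ?M" if "a \<in> ?M" "b \<in> ?M" for a b
        using that keys_add[of a b] by (fastforce simp: poly_ring_def)
    qed
    show "x \<otimes>\<^bsub>poly_ring V\<^esub> a \<in> ?M" if "a \<in> ?M" "x \<in> carrier (poly_ring V)" for x a
      using mult[OF that] by (simp add: poly_ring_def)
    show "a \<otimes>\<^bsub>poly_ring V\<^esub> x \<in> ?M" if "a \<in> ?M" "x \<in> carrier (poly_ring V)" for x a
      using mult[OF that] by (simp add: poly_ring_def mult.commute)
  qed (rule ring_axioms)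
  moreover have "poly_of_mon ` G \<subseteq> ?M"
    using G by (auto simp: keys_poly_of_mon intro: mon_dvd_refl)
  ultimately show "?I \<subseteq> ?M"
    by (rule genideal_minimal)

  interpret I: ideal ?I "poly_ring V :: 'k mpoly ring"
    by (rule genideal_ideal[OF gens])
  have add_closed: "a + b \<in> ?I" if "a \<in> ?I" "b \<in> ?I" for a b
    using I.a_closed[OF that] by (simp add: poly_ring_def)
  have zero_closed: "0 \<in> ?I"
    using I.zero_closed by (simp add: poly_ring_def)
  show "?M \<subseteq> ?I"
  proof
    fix p assume p: "p \<in> ?M"
    have term_closed: "Poly_Mapping.single m (Poly_Mapping.lookup p m) \<in> ?I"
      if m: "m \<in> Poly_Mapping.keys p" for m
    proof -
      obtain g q where g: "g \<in> G" and m_eq: "m = g + q"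
        using p m by (auto simp: mon_dvd_def)
      have q: "Poly_Mapping.single q (Poly_Mapping.lookup p m) \<in> carrier (poly_ring V)"
        using p m by (auto simp: m_eq monomials_add_iff poly_ring_def split: if_splits)
      have "(poly_of_mon g :: 'k mpoly) \<in> ?I"
        using genideal_self[OF gens] g by blast
      from I.I_l_closed[OF this q] show ?thesis
        by (simp add: poly_ring_def poly_of_mon_def mult_single m_eq add.commute)
    qed
    have "(\<Sum>m\<in>A. Poly_Mapping.single m (Poly_Mapping.lookup p m)) \<in> ?I"
      if "finite A" "A \<subseteq> Poly_Mapping.keys p" for A
      using that by (induction A) (auto intro: zero_closed add_closed term_closed)
    then show "p \<in> ?I"
      using poly_eq_sum_of_terms[of p] by (metis finite_keys order_refl)
  qed
qed

lemma Idl_of_monomials_mono: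
  assumes "G \<subseteq> monomials V" "H \<subseteq> monomials V" "\<And>g. g \<in> G \<Longrightarrow> \<exists>h\<in>H. h dvd\<^sub>m g"
  shows "Idl\<^bsub>poly_ring V\<^esub> (poly_of_mon ` G) \<subseteq>
    (Idl\<^bsub>poly_ring V\<^esub> (poly_of_mon ` H) :: 'k::comm_ring_1 mpoly set)"
  unfolding Idl_of_monomials[OF assms(1)] Idl_of_monomials[OF assms(2)]
  using assms(3) mon_dvd_trans by blast

lemma Idl_of_monomials_mem:
  assumes "G \<subseteq> monomials V" "H \<subseteq> monomials V" "g \<in> G"
    and "Idl\<^bsub>poly_ring V\<^esub> (poly_of_mon ` G) =
      (Idl\<^bsub>poly_ring V\<^esub> (poly_of_mon ` H) :: 'k::comm_ring_1 mpoly set)"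
  shows "\<exists>h\<in>H. h dvd\<^sub>m g"
proof -
  have "(poly_of_mon g :: 'k mpoly) \<in> Idl\<^bsub>poly_ring V\<^esub> (poly_of_mon ` G)"
    using assms(1,3) by (auto simp: Idl_of_monomials keys_poly_of_mon intro: mon_dvd_refl)
  then show ?thesis
    unfolding assms(4) by (simp add: Idl_of_monomials[OF assms(2)] keys_poly_of_mon)
qed

text \<open>
  If two sets of monomials generate the same ideal, every member of one is divisible by a member of
  the other. Going there and back from a member of an antichain leads to the same member, so the
  antichain lies in every generating set. This identifies both the numbered generators of the cover
  ideal and the generators of the initial ideal.
\<close>

lemma minimal_monomial_generators_iff:
  assumes H: "H \<subseteq> monomials V" and anti: "\<And>g h. g \<in> H \<Longrightarrow> h \<in> H \<Longrightarrow> g dvd\<^sub>m h \<Longrightarrow> g = h"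
  shows "is_minimal_monomial_generators V
      (Idl\<^bsub>poly_ring V\<^esub> (poly_of_mon ` H) :: 'k::comm_ring_1 mpoly set) G \<longleftrightarrow> G = H"
    (is "?min \<longleftrightarrow> _")
proof
  assume ?min
  then have G: "G \<subseteq> monomials V"
    and eq: "Idl\<^bsub>poly_ring V\<^esub> (poly_of_mon ` G) =
      (Idl\<^bsub>poly_ring V\<^esub> (poly_of_mon ` H) :: 'k mpoly set)"
    and least: "\<And>K. K \<subset> G \<Longrightarrow> Idl\<^bsub>poly_ring V\<^esub> (poly_of_mon ` K) \<noteq>
      (Idl\<^bsub>poly_ring V\<^esub> (poly_of_mon ` H) :: 'k mpoly set)"
    by (auto simp: is_minimal_monomial_generators_def)
  have "H \<subseteq> G"
  proof
    fix h assume h: "h \<in> H"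
    obtain g where g: "g \<in> G" "g dvd\<^sub>m h"
      using Idl_of_monomials_mem[OF H G h eq[symmetric]] by blast
    obtain h' where h': "h' \<in> H" "h' dvd\<^sub>m g"
      using Idl_of_monomials_mem[OF G H g(1) eq] by blast
    have "h' = h"
      using anti[OF h'(1) h] mon_dvd_trans h'(2) g(2) by blast
    then show "h \<in> G"
      using g h'(2) mon_dvd_antisym by blast
  qed
  then show "G = H"
    using least[of H] by blast
next
  assume [simp]: "G = H"
  have "Idl\<^bsub>poly_ring V\<^esub> (poly_of_mon ` K) \<noteq>
      (Idl\<^bsub>poly_ring V\<^esub> (poly_of_mon ` H) :: 'k mpoly set)" if K: "K \<subset> H" for K
  proof
    assume eq: "Idl\<^bsub>poly_ring V\<^esub> (poly_of_mon ` K) =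
      (Idl\<^bsub>poly_ring V\<^esub> (poly_of_mon ` H) :: 'k mpoly set)"
    obtain h where h: "h \<in> H" "h \<notin> K"
      using K by blast
    have "K \<subseteq> monomials V" using K H by blast
    then obtain k where "k \<in> K" "k dvd\<^sub>m h"
      using Idl_of_monomials_mem[OF H _ h(1) eq[symmetric]] by blast
    then show False
      using anti[of k h] h K by blast
  qed
  then show ?min
    using H by (auto simp: is_minimal_monomial_generators_def)
qed


section \<open>The lexicographic order\<close>

lemma var_gt_trans: "var_gt a b \<Longrightarrow> var_gt b c \<Longrightarrow> var_gt a c"
  by (cases a; cases b; cases c) auto

lemma var_gt_total: "a = b \<or> var_gt a b \<or> var_gt b a"
  by (cases a; cases b) auto

lemma lex_less_irrefl: "\<not> m <\<^sub>l\<^sub>e\<^sub>x m"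
  by (auto simp: lex_less_def)

lemma lex_less_trans:
  assumes "a <\<^sub>l\<^sub>e\<^sub>x b" "b <\<^sub>l\<^sub>e\<^sub>x c"
  shows "a <\<^sub>l\<^sub>e\<^sub>x c"
proof -
  obtain v where v: "Poly_Mapping.lookup a v < Poly_Mapping.lookup b v"
    "\<And>w. var_gt w v \<Longrightarrow> Poly_Mapping.lookup a w = Poly_Mapping.lookup b w"
    using assms(1) by (auto simp: lex_less_def)
  obtain v' where v': "Poly_Mapping.lookup b v' < Poly_Mapping.lookup c v'"
    "\<And>w. var_gt w v' \<Longrightarrow> Poly_Mapping.lookup b w = Poly_Mapping.lookup c w"
    using assms(2) by (auto simp: lex_less_def)
  consider "v = v'" | "var_gt v v'" | "var_gt v' v"
    using var_gt_total by blast
  then show ?thesis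
  proof cases
    case 1
    then show ?thesis
      unfolding lex_less_def using v v' by (intro exI[of _ v]) auto
  next
    case 2
    then show ?thesis
      unfolding lex_less_def using v v' var_gt_trans by (intro exI[of _ v]) metis
  next
    case 3
    then show ?thesis
      unfolding lex_less_def using v v' var_gt_trans by (intro exI[of _ v']) metis
  qed
qed

lemma lex_less_asym: "a <\<^sub>l\<^sub>e\<^sub>x b \<Longrightarrow> \<not> b <\<^sub>l\<^sub>e\<^sub>x a"
  using lex_less_irrefl lex_less_trans by blast

lemma lex_less_add_right: "a <\<^sub>l\<^sub>e\<^sub>x b \<Longrightarrow> a + c <\<^sub>l\<^sub>e\<^sub>x b + c"
  by (auto simp: lex_less_def lookup_add)

lemma finite_lex_minimal:
  assumes "finite A" "A \<noteq> {}"
  shows "\<exists>m\<in>A. \<forall>x\<in>A. \<not> x <\<^sub>l\<^sub>e\<^sub>x m"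
proof -
  have "asymp_on A (<\<^sub>l\<^sub>e\<^sub>x)" "transp_on A (<\<^sub>l\<^sub>e\<^sub>x)"
    by (rule asymp_onI, erule lex_less_asym) (rule transp_onI, erule (1) lex_less_trans)
  then have "\<exists>m\<in>A. \<forall>x\<in>A. x \<noteq> m \<longrightarrow> \<not> x <\<^sub>l\<^sub>e\<^sub>x m"
    using Finite_Set.bex_min_element assms by blast
  then show ?thesis
    using lex_less_irrefl by metis
qed


section \<open>The defining ideal of the Rees algebra\<close>

fun var_image :: "(nat \<Rightarrow> monom) \<Rightarrow> var \<Rightarrow> monom" where
  "var_image u (XVar i) = x_mon i"
| "var_image u (YVar j) = u j + t_mon"
| "var_image u TVar = t_mon"

text \<open>
  The map \<open>\<pi>\<close> sends monomials to monomials. Its effect on exponent vectors is additive; the inner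
  sum is an exponent vector multiplied by the natural number \<open>lookup m v\<close>.
\<close>

definition mon_image :: "(nat \<Rightarrow> monom) \<Rightarrow> monom \<Rightarrow> monom" where
  "mon_image u m = (\<Sum>v\<in>Poly_Mapping.keys m. \<Sum>_<Poly_Mapping.lookup m v. var_image u v)"

lemma lookup_mon_image:
  assumes "finite V" "m \<in> monomials V"
  shows "Poly_Mapping.lookup (mon_image u m) w =
    (\<Sum>v\<in>V. Poly_Mapping.lookup m v * Poly_Mapping.lookup (var_image u v) w)"
proof -
  have "Poly_Mapping.lookup (mon_image u m) w =
      (\<Sum>v\<in>Poly_Mapping.keys m. Poly_Mapping.lookup m v * Poly_Mapping.lookup (var_image u v) w)"
    by (simp add: mon_image_def lookup_sum)
  also have "\<dots> = (\<Sum>v\<in>V. Poly_Mapping.lookup m v * Poly_Mapping.lookup (var_image u v) w)"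
    by (rule sum.mono_neutral_left) (use assms in \<open>auto simp: monomials_def in_keys_iff\<close>)
  finally show ?thesis .
qed

lemma mon_image_add: "mon_image u (a + b) = mon_image u a + mon_image u b"
proof (rule poly_mapping_eqI)
  fix w
  let ?V = "Poly_Mapping.keys a \<union> Poly_Mapping.keys b"
  have "a \<in> monomials ?V" "b \<in> monomials ?V" "a + b \<in> monomials ?V"
    by (simp_all add: monomials_def keys_add)
  then show "Poly_Mapping.lookup (mon_image u (a + b)) w =
      Poly_Mapping.lookup (mon_image u a + mon_image u b) w"
    by (simp add: lookup_mon_image[of ?V] lookup_add distrib_right sum.distrib)
qed

lemma mon_image_zero: "mon_image u 0 = 0"
  by (simp add: mon_image_def)

lemma mon_image_sum: "mon_image u (sum f I) = (\<Sum>i\<in>I. mon_image u (f i))"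
  by (induction I rule: infinite_finite_induct) (auto simp: mon_image_add mon_image_zero)

lemma mon_image_single: "mon_image u (Poly_Mapping.single v 1) = var_image u v"
  by (simp add: mon_image_def)

lemma poly_of_mon_add: "poly_of_mon (a + b) = (poly_of_mon a * poly_of_mon b :: 'k::comm_ring_1 mpoly)"
  by (simp add: poly_of_mon_def mult_single)

lemma poly_of_mon_sum:
  "poly_of_mon (sum f I) = (\<Prod>i\<in>I. poly_of_mon (f i) :: 'k::comm_ring_1 mpoly)"
proof (induction I rule: infinite_finite_induct)
  case (insert i I)
  then show ?case by (simp add: poly_of_mon_add)
qed (simp_all add: poly_of_mon_def)

lemma rees_map_eq:
  "rees_map u (p :: 'k::field mpoly) =
     (\<Sum>m\<in>Poly_Mapping.keys p. Poly_Mapping.single (mon_image u m) (Poly_Mapping.lookup p m))"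
proof -
  have img: "rees_image u v = (poly_of_mon (var_image u v) :: 'k mpoly)" for v
    by (cases v) auto
  have "(\<Prod>v\<in>Poly_Mapping.keys m. rees_image u v ^ Poly_Mapping.lookup m v) =
      (poly_of_mon (mon_image u m) :: 'k mpoly)" for m
    by (simp add: mon_image_def poly_of_mon_sum img)
  then show ?thesis
    by (simp add: rees_map_def substitute_def const_poly_def poly_of_mon_def mult_single)
qed

lemma rees_ideal_iff:
  "p \<in> (rees_ideal n s u :: 'k::field mpoly set) \<longleftrightarrow>
     Poly_Mapping.keys p \<subseteq> monomials (T_vars n s) \<and> rees_map u p = 0"
  by (auto simp: rees_ideal_def a_kernel_def' poly_ring_def rees_algebra_def Let_def)

text \<open>
  Since \<open>J\<close> is the kernel of a map of monomials, a monomial is initial exactly when it is not the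
  smallest monomial with its image: the coefficients of a polynomial in \<open>J\<close> sum to zero over
  every fibre of the map, so an initial monomial shares its fibre with another monomial of the
  polynomial, and conversely a difference of two monomials in one fibre lies in \<open>J\<close>.
\<close>

lemma rees_initial_monomial_iff:
  "(\<exists>p\<in>(rees_ideal n s u :: 'k::field mpoly set). is_initial_monomial p m) \<longleftrightarrow>
     m \<in> monomials (T_vars n s) \<and>
     (\<exists>m'\<in>monomials (T_vars n s). mon_image u m' = mon_image u m \<and> m' <\<^sub>l\<^sub>e\<^sub>x m)"
  (is "?initial \<longleftrightarrow> ?fibre")
proof
  assume ?initial
  then obtain p :: "'k mpoly" where p: "p \<in> rees_ideal n s u" "is_initial_monomial p m"
    by blast
  then have m: "m \<in> Poly_Mapping.keys p"
    and keys: "Poly_Mapping.keys p \<subseteq> monomials (T_vars n s)"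
    by (auto simp: is_initial_monomial_def rees_ideal_iff)
  have "\<exists>m'\<in>Poly_Mapping.keys p. m' \<noteq> m \<and> mon_image u m' = mon_image u m"
  proof (rule ccontr)
    assume none: "\<not> ?thesis"
    have "0 = Poly_Mapping.lookup (rees_map u p) (mon_image u m)"
      using p by (simp add: rees_ideal_iff)
    also have "\<dots> = (\<Sum>m'\<in>Poly_Mapping.keys p. if m' = m then Poly_Mapping.lookup p m' else 0)"
      unfolding rees_map_eq lookup_sum
      by (rule sum.cong) (use none in \<open>auto simp: lookup_single when_def\<close>)
    also have "\<dots> = Poly_Mapping.lookup p m"
      using m by simp
    finally show False
      using m by (simp add: in_keys_iff)
  qed
  then show ?fibre
    using p(2) keys m by (auto simp: is_initial_monomial_def)
next
  assume ?fibre
  then obtain m' where m: "m \<in> monomials (T_vars n s)" "m' \<in> monomials (T_vars n s)"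
    "mon_image u m' = mon_image u m" "m' <\<^sub>l\<^sub>e\<^sub>x m"
    by blast
  then have ne: "m \<noteq> m'"
    using lex_less_irrefl by blast
  let ?p = "poly_of_mon m - poly_of_mon m' :: 'k mpoly"
  have lookup: "Poly_Mapping.lookup ?p k = (if k = m then 1 else if k = m' then - 1 else 0)" for k
    using ne by (auto simp: poly_of_mon_def lookup_minus lookup_single when_def)
  have keys: "Poly_Mapping.keys ?p = {m, m'}"
    by (auto simp: in_keys_iff lookup split: if_splits)
  have "rees_map u ?p = 0"
    unfolding rees_map_eq keys using ne m(3) by (simp add: lookup flip: single_add)
  then have "?p \<in> rees_ideal n s u"
    using m by (simp add: rees_ideal_iff keys)
  moreover have "is_initial_monomial ?p m"
    using m by (simp add: is_initial_monomial_def keys)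
  ultimately show ?initial ..
qed


section \<open>Vertex covers of a path\<close>

definition cover_mon :: "nat set \<Rightarrow> monom" where
  "cover_mon D = (\<Sum>i\<in>D. x_mon i)"

lemma lookup_cover_mon_X:
  "finite D \<Longrightarrow> Poly_Mapping.lookup (cover_mon D) (XVar i) = of_bool (i \<in> D)"
  by (simp add: cover_mon_def lookup_sum lookup_single when_def)

lemma lookup_cover_mon_other:
  "Poly_Mapping.lookup (cover_mon D) (YVar j) = 0" "Poly_Mapping.lookup (cover_mon D) TVar = 0"
  by (simp_all add: cover_mon_def lookup_sum lookup_single)

lemma cover_mon_dvd_iff: "finite D \<Longrightarrow> finite E \<Longrightarrow> cover_mon D dvd\<^sub>m cover_mon E \<longleftrightarrow> D \<subseteq> E"
proof
  assume fin: "finite D" "finite E" and dvd: "cover_mon D dvd\<^sub>m cover_mon E"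
  show "D \<subseteq> E"
  proof
    fix i assume "i \<in> D"
    then show "i \<in> E"
      using fin dvd[unfolded mon_dvd_iff_lookup_le, rule_format, of "XVar i"]
      by (simp add: lookup_cover_mon_X split: if_splits split_of_bool_asm)
  qed
next
  assume fin: "finite D" "finite E" and "D \<subseteq> E"
  then have "cover_mon E = cover_mon D + cover_mon (E - D)"
    by (simp add: cover_mon_def sum.subset_diff add.commute)
  then show "cover_mon D dvd\<^sub>m cover_mon E"
    by (auto simp: mon_dvd_def)
qed

lemma cover_mon_inject:
  "finite D \<Longrightarrow> finite E \<Longrightarrow> cover_mon D = cover_mon E \<Longrightarrow> D = E"
  using cover_mon_dvd_iff[of D E] cover_mon_dvd_iff[of E D] by (simp add: mon_dvd_refl)

lemma cover_mon_subset:
  "finite D \<Longrightarrow> E \<subseteq> D \<Longrightarrow> cover_mon D = cover_mon (D - E) + cover_mon E"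
  by (simp add: cover_mon_def sum.subset_diff)

lemma cover_mon_sum_eqI:
  assumes "finite R" "finite P" "finite Q" "finite A" "finite B"
    and "\<And>i. of_bool (i \<in> R) + of_bool (i \<in> P) + of_bool (i \<in> Q) =
      (of_bool (i \<in> A) + of_bool (i \<in> B) :: nat)"
  shows "cover_mon R + cover_mon P + cover_mon Q = cover_mon A + cover_mon B"
proof (rule poly_mapping_eqI)
  fix v
  show "Poly_Mapping.lookup (cover_mon R + cover_mon P + cover_mon Q) v =
      Poly_Mapping.lookup (cover_mon A + cover_mon B) v"
    using assms by (cases v) (simp_all add: lookup_add lookup_cover_mon_X lookup_cover_mon_other)
qed

text \<open>
  Losing \<open>k\<close> without gaining any smaller vertex makes the monomial smaller: the least vertex of
  \<open>C - D\<close> is then the first place where the two differ.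
\<close>

lemma cover_mon_lex_lessI:
  assumes fin: "finite C" "finite D"
    and k: "k \<in> C" "k \<notin> D" "\<And>i. i < k \<Longrightarrow> i \<in> D \<Longrightarrow> i \<in> C"
  shows "cover_mon D <\<^sub>l\<^sub>e\<^sub>x cover_mon C"
proof -
  define a where "a = (LEAST i. i \<in> C \<and> i \<notin> D)"
  have a: "a \<in> C \<and> a \<notin> D"
    unfolding a_def by (rule LeastI[of _ k]) (use k in simp)
  have "a \<le> k"
    unfolding a_def by (rule Least_le) (use k in simp)
  have same: "i \<in> D \<longleftrightarrow> i \<in> C" if "i < a" for i
    using not_less_Least[of i "\<lambda>i. i \<in> C \<and> i \<notin> D"] that k(3)[of i] \<open>a \<le> k\<close>
    unfolding a_def by auto
  have "Poly_Mapping.lookup (cover_mon D) w = Poly_Mapping.lookup (cover_mon C) w"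
    if "var_gt w (XVar a)" for w
    using that same fin by (cases w) (simp_all add: lookup_cover_mon_X lookup_cover_mon_other)
  then show ?thesis
    unfolding lex_less_def using a fin by (intro exI[of _ "XVar a"]) (simp add: lookup_cover_mon_X)
qed

lemma cover_mon_lex_lessE:
  assumes "finite C" "finite D" "cover_mon D <\<^sub>l\<^sub>e\<^sub>x cover_mon C"
  obtains a where "a \<in> C" "a \<notin> D" "\<And>i. i < a \<Longrightarrow> i \<in> D \<longleftrightarrow> i \<in> C"
proof -
  obtain v where v: "Poly_Mapping.lookup (cover_mon D) v < Poly_Mapping.lookup (cover_mon C) v"
    "\<And>w. var_gt w v \<Longrightarrow> Poly_Mapping.lookup (cover_mon D) w = Poly_Mapping.lookup (cover_mon C) w"
    using assms(3) by (auto simp: lex_less_def)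
  then obtain a where a: "v = XVar a"
    by (cases v) (auto simp: lookup_cover_mon_other)
  have "i \<in> D \<longleftrightarrow> i \<in> C" if "i < a" for i
    using v(2)[of "XVar i"] that assms(1,2) by (auto simp: a lookup_cover_mon_X split: if_splits split_of_bool_asm)
  moreover have "a \<in> C" "a \<notin> D"
    using v(1) assms(1,2) by (auto simp: a lookup_cover_mon_X split: if_splits split_of_bool_asm)
  ultimately show thesis
    using that by blast
qed

lemma path_vertex_cover_iff:
  "vertex_cover {1..n} (path_edges n) D \<longleftrightarrow>
     D \<subseteq> {1..n} \<and> (\<forall>i. 1 \<le> i \<and> i < n \<longrightarrow> i \<in> D \<or> i + 1 \<in> D)"
proof -
  have "{i, i + 1} \<inter> D \<noteq> {} \<longleftrightarrow> i \<in> D \<or> i + 1 \<in> D" for i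
    by blast
  then show ?thesis
    unfolding vertex_cover_def path_edges_def by auto
qed

abbreviation min_path_covers :: "nat \<Rightarrow> nat set set" where
  "min_path_covers n \<equiv> {D. minimal_vertex_cover {1..n} (path_edges n) D}"

lemma min_path_cover_is_cover:
  "D \<in> min_path_covers n \<Longrightarrow> vertex_cover {1..n} (path_edges n) D"
  by (simp add: minimal_vertex_cover_def)

lemma min_path_cover_subset: "D \<in> min_path_covers n \<Longrightarrow> D \<subseteq> {1..n}"
  using min_path_cover_is_cover unfolding vertex_cover_def by blast

lemma min_path_cover_finite: "D \<in> min_path_covers n \<Longrightarrow> finite D"
  using min_path_cover_subset finite_subset by blast

lemma min_path_cover_edge:
  "D \<in> min_path_covers n \<Longrightarrow> 1 \<le> i \<Longrightarrow> i < n \<Longrightarrow> i \<in> D \<or> i + 1 \<in> D"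
  using min_path_cover_is_cover unfolding path_vertex_cover_iff by blast

lemma min_path_cover_irredundant:
  assumes D: "D \<in> min_path_covers n" and i: "i \<in> D"
  shows "(2 \<le> i \<and> i - 1 \<notin> D) \<or> (i < n \<and> i + 1 \<notin> D)"
proof -
  have "D - {i} \<subset> D" using i by blast
  then have "\<not> vertex_cover {1..n} (path_edges n) (D - {i})"
    using D by (simp add: minimal_vertex_cover_def)
  then obtain k where k: "1 \<le> k" "k < n" "k \<notin> D - {i}" "k + 1 \<notin> D - {i}"
    using min_path_cover_subset[OF D] unfolding path_vertex_cover_iff by blast
  then have "k = i \<or> k + 1 = i"
    using min_path_cover_edge[OF D k(1,2)] by blast
  then show ?thesis
    using k by auto
qed

text \<open>
  Otherwise \<open>i\<close> would be redundant, its edges being covered from their other ends. So a minimal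
  cover has no three consecutive vertices and contains neither \<open>{1, 2}\<close> nor \<open>{n - 1, n}\<close>.
\<close>

lemma min_path_cover_pair_less:
  "D \<in> min_path_covers n \<Longrightarrow> i \<in> D \<Longrightarrow> i = 1 \<or> i - 1 \<in> D \<Longrightarrow> i < n \<and> i + 1 \<notin> D"
  using min_path_cover_irredundant[of D n i] by auto

lemma vertex_cover_contains_minimal:
  assumes "finite D" "vertex_cover V E D"
  shows "\<exists>C\<subseteq>D. minimal_vertex_cover V E C"
  using assms
proof (induction D rule: finite_psubset_induct)
  case (psubset D)
  show ?case
  proof (cases "minimal_vertex_cover V E D")
    case False
    then obtain C where "C \<subset> D" "vertex_cover V E C"
      using psubset.prems by (auto simp: minimal_vertex_cover_def)
    then show ?thesis
      using psubset.IH[of C] by blast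
  qed blast
qed

lemma min_path_covers_antichain:
  "C \<in> min_path_covers n \<Longrightarrow> D \<in> min_path_covers n \<Longrightarrow> C \<subseteq> D \<Longrightarrow> C = D"
  by (auto simp: minimal_vertex_cover_def)

lemma generators_of_vertex_cover_ideal:
  assumes "is_minimal_monomial_generators (S_vars n) (vertex_cover_ideal n :: 'k::field mpoly set) G"
  shows "G = cover_mon ` min_path_covers n"
proof -
  have eq: "(vertex_cover_ideal n :: 'k mpoly set) =
      Idl\<^bsub>poly_ring (S_vars n)\<^esub> (poly_of_mon ` cover_mon ` min_path_covers n)"
    unfolding vertex_cover_ideal_def cover_mon_def
    by (rule arg_cong[where f = "genideal _"]) blast
  have "cover_mon ` min_path_covers n \<subseteq> monomials (S_vars n)"
    using min_path_cover_subset
    by (force simp: cover_mon_def S_vars_def intro!: monomials_sumI single_in_monomials)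
  moreover have "g = h" if "g \<in> cover_mon ` min_path_covers n" "h \<in> cover_mon ` min_path_covers n"
    "g dvd\<^sub>m h" for g h
    using that min_path_covers_antichain cover_mon_dvd_iff min_path_cover_finite by blast
  ultimately show ?thesis
    using assms unfolding eq by (simp only: minimal_monomial_generators_iff)
qed


section \<open>The numbered generators\<close>

text \<open>
  The set \<open>C j\<close> is the support of \<open>u j\<close>; working with it replaces divisibility by membership.
\<close>

locale numbered_path_covers =
  fixes n s :: nat and u :: "nat \<Rightarrow> monom" and C :: "nat \<Rightarrow> nat set"
  assumes covers: "C ` {1..s} = min_path_covers n"
    and u_eq: "j \<in> {1..s} \<Longrightarrow> u j = cover_mon (C j)"
    and u_decreasing: "1 \<le> i \<Longrightarrow> i < j \<Longrightarrow> j \<le> s \<Longrightarrow> u j <\<^sub>l\<^sub>e\<^sub>x u i"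
begin

lemma C_min: "j \<in> {1..s} \<Longrightarrow> C j \<in> min_path_covers n"
  using covers by blast

lemma C_finite: "j \<in> {1..s} \<Longrightarrow> finite (C j)"
  using C_min min_path_cover_finite by blast

lemma C_inj: "inj_on C {1..s}"
proof (rule linorder_inj_onI)
  fix i j assume ij: "i < j" "i \<in> {1..s}" "j \<in> {1..s}"
  then show "C i \<noteq> C j"
    using u_decreasing[of i j] lex_less_irrefl by (auto simp: u_eq)
qed auto

lemma index_less_iff:
  assumes "j \<in> {1..s}" "k \<in> {1..s}"
  shows "j < k \<longleftrightarrow> cover_mon (C k) <\<^sub>l\<^sub>e\<^sub>x cover_mon (C j)"
proof -
  have gen: "cover_mon (C b) <\<^sub>l\<^sub>e\<^sub>x cover_mon (C a)" if "a < b" "a \<in> {1..s}" "b \<in> {1..s}" for a b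
    using u_decreasing[of a b] that by (simp add: u_eq)
  show ?thesis
    using gen[of j k] gen[of k j] lex_less_asym lex_less_irrefl assms
    by (metis linorder_neqE_nat)
qed

lemma obtain_minimal_index:
  assumes "vertex_cover {1..n} (path_edges n) P"
  obtains p where "p \<in> {1..s}" "C p \<subseteq> P" "finite P"
proof -
  have fin: "finite P"
    using assms finite_subset by (auto simp: vertex_cover_def)
  obtain D where D: "D \<subseteq> P" "minimal_vertex_cover {1..n} (path_edges n) D"
    using vertex_cover_contains_minimal[OF fin assms] by blast
  then have "D \<in> C ` {1..s}"
    unfolding covers by simp
  then obtain p where "p \<in> {1..s}" "C p = D"
    by blast
  then show thesis
    using that D(1) fin by blast
qed

lemma lookup_u_X: "j \<in> {1..s} \<Longrightarrow> Poly_Mapping.lookup (u j) (XVar i) = of_bool (i \<in> C j)"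
  by (simp add: u_eq lookup_cover_mon_X C_finite)

lemma x_dvd_u_iff: "j \<in> {1..s} \<Longrightarrow> x_mon i dvd\<^sub>m u j \<longleftrightarrow> i \<in> C j"
  unfolding mon_dvd_iff_lookup_le
  by (auto simp: lookup_single when_def lookup_u_X)

lemma xx_dvd_u_iff:
  "j \<in> {1..s} \<Longrightarrow> i \<noteq> k \<Longrightarrow> (x_mon i + x_mon k) dvd\<^sub>m u j \<longleftrightarrow> i \<in> C j \<and> k \<in> C j"
  unfolding mon_dvd_iff_lookup_le
  by (auto simp: lookup_single when_def lookup_add lookup_u_X split: if_splits split_of_bool_asm)

lemma zero_notin_C: "j \<in> {1..s} \<Longrightarrow> 0 \<notin> C j"
  using C_min min_path_cover_subset by fastforce

lemma x0_dvd_u_iff: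
  "j \<in> {1..s} \<Longrightarrow> 1 \<le> i \<Longrightarrow>
    (x_mon (i - 1) + x_mon i) dvd\<^sub>m (x_mon 0 + u j) \<longleftrightarrow> i \<in> C j \<and> (i = 1 \<or> i - 1 \<in> C j)"
  unfolding mon_dvd_iff_lookup_le using zero_notin_C[of j]
  by (auto simp: lookup_single when_def lookup_add lookup_u_X split: if_splits split_of_bool_asm)

lemma supp_u: "j \<in> {1..s} \<Longrightarrow> supp (u j) = C j"
  unfolding supp_def using x_dvd_u_iff by blast

lemma A_set_eq:
  "A_set n s u = {x_mon (i + 1) + y_mon j | i j.
     1 \<le> i \<and> i < n \<and> j \<in> {1..s} \<and> i \<in> C j \<and> (i = 1 \<or> i - 1 \<in> C j)}"
  unfolding A_set_def using x0_dvd_u_iff by (intro Collect_cong ex_cong1) auto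

text \<open>
  The conditions that define \<open>\<B>\<^sub>n\<close>, in terms of covers. In the first one \<open>C j\<close> and \<open>C k\<close> can
  exchange their parts from \<open>i\<close> on, and the order of \<open>j\<close> and \<open>k\<close> matters; in the other two the
  covers overlap in \<open>i\<close> and exchange their parts beyond it.
\<close>

definition B_pair :: "nat \<Rightarrow> nat \<Rightarrow> bool" where
  "B_pair j k \<longleftrightarrow>
     (\<exists>i. 3 \<le> i \<and> i \<le> n - 1 \<and> (i - 1 \<in> C j \<and> i \<in> C j) \<and> i - 2 \<notin> C k \<and> i \<notin> C k \<and>
        C j \<inter> {1..i - 3} \<noteq> C k \<inter> {1..i - 3}) \<or>
     (\<exists>i. 3 \<le> i \<and> i \<le> n - 2 \<and> (i \<in> C j \<and> i + 1 \<in> C j) \<and> i - 1 \<in> C k \<and> i \<in> C k) \<or>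
     (\<exists>i. 3 \<le> i \<and> i \<le> n - 2 \<and> (i - 1 \<in> C j \<and> i \<in> C j) \<and> i \<in> C k \<and> i + 1 \<in> C k)"

lemma B_set_eq:
  "B_set n s u = {y_mon j + y_mon k | j k. 1 \<le> j \<and> j < k \<and> k \<le> s \<and> B_pair j k}"
proof -
  have pred: "(x_mon (i - 1) + x_mon i) dvd\<^sub>m u j \<longleftrightarrow> i - 1 \<in> C j \<and> i \<in> C j"
    if "j \<in> {1..s}" "3 \<le> i" for i j
    by (rule xx_dvd_u_iff) (use that in auto)
  have succ: "(x_mon i + x_mon (i + 1)) dvd\<^sub>m u j \<longleftrightarrow> i \<in> C j \<and> i + 1 \<in> C j"
    if "j \<in> {1..s}" for i j
    by (rule xx_dvd_u_iff) (use that in auto)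
  have "((\<exists>i. 3 \<le> i \<and> i \<le> n - 1 \<and>
              (x_mon (i - 1) + x_mon i) dvd\<^sub>m u j \<and>
              \<not> x_mon (i - 2) dvd\<^sub>m u k \<and> \<not> x_mon i dvd\<^sub>m u k \<and>
              supp (u j) \<inter> {1..i - 3} \<noteq> supp (u k) \<inter> {1..i - 3}) \<or>
         (\<exists>i. 3 \<le> i \<and> i \<le> n - 2 \<and>
              (x_mon i + x_mon (i + 1)) dvd\<^sub>m u j \<and>
              (x_mon (i - 1) + x_mon i) dvd\<^sub>m u k) \<or>
         (\<exists>i. 3 \<le> i \<and> i \<le> n - 2 \<and>
              (x_mon (i - 1) + x_mon i) dvd\<^sub>m u j \<and>
              (x_mon i + x_mon (i + 1)) dvd\<^sub>m u k)) \<longleftrightarrow> B_pair j k"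
    if "j \<in> {1..s}" "k \<in> {1..s}" for j k
    unfolding B_pair_def
    by (intro arg_cong2[where f = "(\<or>)"] ex_cong1 conj_cong refl)
      (simp_all only: pred[OF that(1)] pred[OF that(2)] succ[OF that(1)] succ[OF that(2)]
        x_dvd_u_iff[OF that(2)] supp_u[OF that(1)] supp_u[OF that(2)])
  then show ?thesis
    unfolding B_set_def by (intro Collect_cong ex_cong1 conj_cong refl) simp_all
qed

lemma AB_set_in_monomials: "A_set n s u \<union> B_set n s u \<subseteq> monomials (T_vars n s)"
  unfolding A_set_eq B_set_eq T_vars_def
  by (auto simp: monomials_add_iff intro!: single_in_monomials)

lemma AB_set_degree: "m \<in> A_set n s u \<union> B_set n s u \<Longrightarrow> mon_degree m = 2"
  unfolding A_set_def B_set_def by (auto simp: mon_degree_add mon_degree_single)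


section \<open>The listed monomials are initial\<close>

lemma mon_image_x: "mon_image u (x_mon i) = x_mon i"
  and mon_image_y: "mon_image u (y_mon j) = u j + t_mon"
  by (simp_all only: mon_image_single var_image.simps)

lemma mon_image_cover_mon: "mon_image u (cover_mon D) = cover_mon D"
  by (simp only: cover_mon_def mon_image_sum mon_image_x)

lemma x_mon_in_monomials: "i \<in> {1..n} \<Longrightarrow> x_mon i \<in> monomials (T_vars n s)"
  by (simp add: T_vars_def single_in_monomials)

lemma y_mon_in_monomials: "j \<in> {1..s} \<Longrightarrow> y_mon j \<in> monomials (T_vars n s)"
  by (simp add: T_vars_def single_in_monomials)

lemma cover_mon_in_monomials: "D \<subseteq> {1..n} \<Longrightarrow> cover_mon D \<in> monomials (T_vars n s)"
  unfolding cover_mon_def by (rule monomials_sumI, rule x_mon_in_monomials) blast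

text \<open>Every \<open>y\<close> variable exceeds every \<open>x\<close> variable, so the first \<open>y\<close> index with different
  exponents decides.\<close>

lemma lex_less_by_y_index:
  assumes "Poly_Mapping.lookup a (YVar j) < Poly_Mapping.lookup b (YVar j)"
    and "\<And>k. k < j \<Longrightarrow> Poly_Mapping.lookup a (YVar k) = Poly_Mapping.lookup b (YVar k)"
    and "Poly_Mapping.lookup a TVar = Poly_Mapping.lookup b TVar"
  shows "a <\<^sub>l\<^sub>e\<^sub>x b"
proof -
  have "Poly_Mapping.lookup a w = Poly_Mapping.lookup b w" if "var_gt w (YVar j)" for w
    using that assms by (cases w) auto
  then show ?thesis
    unfolding lex_less_def using assms(1) by blast
qed

text \<open>
  In a cover containing \<open>i - 1\<close> and \<open>i\<close> (or \<open>i = 1\<close>), the vertex \<open>i\<close> is needed only for the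
  edge to \<open>i + 1\<close>, so it can be traded for \<open>i + 1\<close>; this makes the cover smaller.
\<close>

lemma A_set_reduces:
  assumes "a \<in> A_set n s u"
  shows "\<exists>a'\<in>monomials (T_vars n s). mon_image u a' = mon_image u a \<and> a' <\<^sub>l\<^sub>e\<^sub>x a"
proof -
  obtain i j where a: "a = x_mon (i + 1) + y_mon j" and i: "1 \<le> i" "i < n" and j: "j \<in> {1..s}"
    and C: "i \<in> C j" "i = 1 \<or> i - 1 \<in> C j"
    using assms unfolding A_set_eq by blast
  have next_notin: "i + 1 \<notin> C j"
    using min_path_cover_pair_less[OF C_min[OF j]] C by blast
  have sub: "C j \<subseteq> {1..n}"
    using min_path_cover_subset C_min j by blast
  \<comment> \<open>Still a cover, but \<open>i + 2\<close> may have become redundant in it.\<close>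
  define P where "P = insert (i + 1) (C j - {i})"
  have "k \<in> P \<or> k + 1 \<in> P" if "1 \<le> k" "k < n" for k
    using min_path_cover_edge[OF C_min[OF j] that] C i that unfolding P_def by auto
  then have "vertex_cover {1..n} (path_edges n) P"
    unfolding path_vertex_cover_iff using sub i by (auto simp: P_def)
  then obtain p where p: "p \<in> {1..s}" "C p \<subseteq> P" "finite P"
    by (rule obtain_minimal_index)
  have "cover_mon (C p) <\<^sub>l\<^sub>e\<^sub>x cover_mon (C j)"
    by (rule cover_mon_lex_lessI[of _ _ i]) (use C C_finite p j in \<open>auto simp: P_def\<close>)
  then have jp: "j < p"
    using index_less_iff[OF j p(1)] by blast
  let ?a = "x_mon i + cover_mon (P - C p) + y_mon p"
  have "cover_mon P = cover_mon (P - C p) + cover_mon (C p)"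
    using cover_mon_subset p by blast
  moreover have "cover_mon P = x_mon (i + 1) + cover_mon (C j - {i})"
    unfolding P_def cover_mon_def using C_finite[OF j] next_notin by (subst sum.insert) auto
  moreover have "cover_mon (C j) = x_mon i + cover_mon (C j - {i})"
    unfolding cover_mon_def using C_finite[OF j] C by (simp add: sum.remove)
  ultimately have eq: "x_mon i + cover_mon (P - C p) + cover_mon (C p) = x_mon (i + 1) + cover_mon (C j)"
    by (metis add.assoc add.left_commute)
  have "mon_image u ?a = x_mon i + cover_mon (P - C p) + cover_mon (C p) + t_mon"
    by (simp only: mon_image_add mon_image_x mon_image_y mon_image_cover_mon u_eq[OF p(1)] add.assoc)
  also have "\<dots> = mon_image u a"
    unfolding eq a by (simp only: mon_image_add mon_image_x mon_image_y u_eq[OF j] add.assoc)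
  finally have "mon_image u ?a = mon_image u a" .
  moreover have "?a \<in> monomials (T_vars n s)"
    using p i sub unfolding monomials_add_iff P_def
    by (intro conjI x_mon_in_monomials y_mon_in_monomials cover_mon_in_monomials) auto
  moreover have "?a <\<^sub>l\<^sub>e\<^sub>x a"
    by (rule lex_less_by_y_index[of _ j])
      (use jp in \<open>auto simp: a lookup_add lookup_single lookup_cover_mon_other\<close>)
  ultimately show ?thesis by blast
qed

text \<open>
  Rewriting a product of two covers as a product of two other covers \<open>P\<close>, \<open>Q\<close> and some \<open>x\<close>
  variables. The covers \<open>P\<close>, \<open>Q\<close> need not be minimal: the vertices that can be dropped are moved to
  the \<open>x\<close> part.
\<close>

lemma cover_exchange:
  assumes j: "j \<in> {1..s}" and k: "k \<in> {1..s}"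
    and P: "vertex_cover {1..n} (path_edges n) P" and Q: "vertex_cover {1..n} (path_edges n) Q"
    and R: "R \<subseteq> {1..n}"
    and eq: "cover_mon R + cover_mon P + cover_mon Q = cover_mon (C j) + cover_mon (C k)"
    and P_less: "\<And>p. p \<in> {1..s} \<Longrightarrow> C p \<subseteq> P \<Longrightarrow> min j k < p"
    and Q_less: "\<And>q. q \<in> {1..s} \<Longrightarrow> C q \<subseteq> Q \<Longrightarrow> min j k < q"
  shows "\<exists>a'\<in>monomials (T_vars n s).
    mon_image u a' = mon_image u (y_mon j + y_mon k) \<and> a' <\<^sub>l\<^sub>e\<^sub>x y_mon j + y_mon k"
proof -
  obtain p where p: "p \<in> {1..s}" "C p \<subseteq> P" "finite P"
    using P by (rule obtain_minimal_index)
  obtain q where q: "q \<in> {1..s}" "C q \<subseteq> Q" "finite Q"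
    using Q by (rule obtain_minimal_index)
  let ?r = "cover_mon R + cover_mon (P - C p) + cover_mon (Q - C q)"
  let ?a = "?r + (y_mon p + y_mon q)"
  have "?r + (cover_mon (C p) + cover_mon (C q)) =
      cover_mon R + (cover_mon (P - C p) + cover_mon (C p)) + (cover_mon (Q - C q) + cover_mon (C q))"
    by (simp only: ac_simps)
  also have "\<dots> = cover_mon (C j) + cover_mon (C k)"
    using cover_mon_subset[OF p(3,2)] cover_mon_subset[OF q(3,2)] eq by simp
  finally have r: "?r + (cover_mon (C p) + cover_mon (C q)) = cover_mon (C j) + cover_mon (C k)" .
  have "mon_image u ?a = ?r + (cover_mon (C p) + cover_mon (C q)) + (t_mon + t_mon)"
    by (simp only: mon_image_add mon_image_y mon_image_cover_mon u_eq[OF p(1)] u_eq[OF q(1)] ac_simps)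
  also have "\<dots> = mon_image u (y_mon j + y_mon k)"
    unfolding r by (simp only: mon_image_add mon_image_y u_eq[OF j] u_eq[OF k] ac_simps)
  finally have "mon_image u ?a = mon_image u (y_mon j + y_mon k)" .
  moreover have "?a \<in> monomials (T_vars n s)"
  proof -
    have "P \<subseteq> {1..n}" "Q \<subseteq> {1..n}"
      using P Q by (simp_all add: vertex_cover_def)
    then show ?thesis
      using p(1) q(1) R unfolding monomials_add_iff
      by (intro conjI cover_mon_in_monomials y_mon_in_monomials) auto
  qed
  moreover have "?a <\<^sub>l\<^sub>e\<^sub>x y_mon j + y_mon k"
    by (rule lex_less_by_y_index[of _ "min j k"])
      (use P_less[OF p(1,2)] Q_less[OF q(1,2)] in
        \<open>auto simp: lookup_add lookup_single lookup_cover_mon_other when_def\<close>)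
  ultimately show ?thesis by blast
qed

text \<open>
  If \<open>i\<close> and \<open>i + 1\<close> lie in one cover and \<open>i - 1\<close> and \<open>i\<close> in the other, the covers can
  exchange their tails beyond \<open>i\<close>, after which one of the two copies of \<open>i\<close> is redundant.
\<close>

lemma overlapping_pairs_reduce:
  assumes j: "j \<in> {1..s}" and k: "k \<in> {1..s}" and i: "2 \<le> i"
    and Cj: "i \<in> C j" "i + 1 \<in> C j" and Ck: "i - 1 \<in> C k" "i \<in> C k"
  shows "\<exists>a'\<in>monomials (T_vars n s).
    mon_image u a' = mon_image u (y_mon j + y_mon k) \<and> a' <\<^sub>l\<^sub>e\<^sub>x y_mon j + y_mon k"
proof -
  define P where "P = C j \<inter> {..i} \<union> C k \<inter> {i<..}"
  define Q where "Q = C k \<inter> {..<i} \<union> C j \<inter> {i<..}"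
  have in_n: "i < n" and k_next: "i + 1 \<notin> C k"
    using min_path_cover_pair_less[OF C_min[OF k]] Ck by auto
  note edge = min_path_cover_edge[OF C_min[OF j]] min_path_cover_edge[OF C_min[OF k]]
  have sub: "C j \<subseteq> {1..n}" "C k \<subseteq> {1..n}"
    using min_path_cover_subset C_min j k by blast+
  have fin: "finite P" "finite Q"
    unfolding P_def Q_def using C_finite j k by auto
  show ?thesis
  proof (rule cover_exchange[OF j k])
    have "l \<in> P \<or> l + 1 \<in> P" if "1 \<le> l" "l < n" for l
      using edge[OF that] Cj unfolding P_def by (cases "l < i"; cases "l = i") auto
    then show "vertex_cover {1..n} (path_edges n) P"
      unfolding path_vertex_cover_iff using sub by (auto simp: P_def)
    have "l \<in> Q \<or> l + 1 \<in> Q" if "1 \<le> l" "l < n" for l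
    proof -
      consider "l + 1 < i" | "l = i - 1" | "l = i" | "i < l" by linarith
      then show ?thesis
        by cases (use edge[OF that] Cj Ck i in \<open>auto simp: Q_def\<close>)
    qed
    then show "vertex_cover {1..n} (path_edges n) Q"
      unfolding path_vertex_cover_iff using sub by (auto simp: Q_def)
    show "{i} \<subseteq> {1..n}"
      using in_n i by simp
    show "cover_mon {i} + cover_mon P + cover_mon Q = cover_mon (C j) + cover_mon (C k)"
      by (rule cover_mon_sum_eqI)
        (use fin C_finite j k Cj Ck in \<open>auto simp: P_def Q_def\<close>)
    show "min j k < p" if p: "p \<in> {1..s}" "C p \<subseteq> P" for p
    proof -
      have "cover_mon (C p) <\<^sub>l\<^sub>e\<^sub>x cover_mon (C j)"
        by (rule cover_mon_lex_lessI[of _ _ "i + 1"])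
          (use p Cj k_next C_finite j in \<open>auto simp: P_def\<close>)
      then show ?thesis
        using index_less_iff[OF j p(1)] by simp
    qed
    show "min j k < q" if q: "q \<in> {1..s}" "C q \<subseteq> Q" for q
    proof -
      have "cover_mon (C q) <\<^sub>l\<^sub>e\<^sub>x cover_mon (C k)"
        by (rule cover_mon_lex_lessI[of _ _ i])
          (use q Ck C_finite k in \<open>auto simp: Q_def\<close>)
      then show ?thesis
        using index_less_iff[OF k q(1)] by simp
    qed
  qed
qed

text \<open>
  Here both covers contain \<open>i - 1\<close> and not \<open>i - 2\<close>, so they can exchange their tails from \<open>i\<close> on.
  The larger cover \<open>C j\<close> loses \<open>i\<close>, and what becomes of \<open>C k\<close> is still smaller than \<open>C j\<close>
  because the two already differ before \<open>i - 2\<close>.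
\<close>

lemma unsorted_pair_reduces:
  assumes j: "j \<in> {1..s}" and k: "k \<in> {1..s}" and jk: "j < k" and i: "3 \<le> i" "i < n"
    and Cj: "i - 1 \<in> C j" "i \<in> C j" and Ck: "i - 2 \<notin> C k" "i \<notin> C k"
    and differ: "C j \<inter> {1..i - 3} \<noteq> C k \<inter> {1..i - 3}"
  shows "\<exists>a'\<in>monomials (T_vars n s).
    mon_image u a' = mon_image u (y_mon j + y_mon k) \<and> a' <\<^sub>l\<^sub>e\<^sub>x y_mon j + y_mon k"
proof -
  define P where "P = C j \<inter> {..<i} \<union> C k \<inter> {i..}"
  define Q where "Q = C k \<inter> {..<i} \<union> C j \<inter> {i..}"
  note edge = min_path_cover_edge[OF C_min[OF j]] min_path_cover_edge[OF C_min[OF k]]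
  have "i - 2 + 1 = i - 1" using i by simp
  then have k_prev: "i - 1 \<in> C k"
    using edge(2)[of "i - 2"] Ck i by auto
  have sub: "C j \<subseteq> {1..n}" "C k \<subseteq> {1..n}"
    using min_path_cover_subset C_min j k by blast+
  have fin: "finite P" "finite Q"
    unfolding P_def Q_def using C_finite j k by auto
  obtain a where a: "a \<in> C j" "a \<notin> C k" "\<And>l. l < a \<Longrightarrow> l \<in> C k \<longleftrightarrow> l \<in> C j"
    using cover_mon_lex_lessE[OF C_finite[OF j] C_finite[OF k]] index_less_iff[OF j k] jk by metis
  have "a \<le> i - 3"
  proof (rule ccontr)
    assume "\<not> a \<le> i - 3"
    then have "C j \<inter> {1..i - 3} = C k \<inter> {1..i - 3}"
      using a(3) by auto
    then show False using differ by blast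
  qed
  show ?thesis
  proof (rule cover_exchange[OF j k])
    have cases: "l + 1 < i \<or> l = i - 1 \<or> i \<le> l" for l
      by linarith
    have "l \<in> P \<or> l + 1 \<in> P" if "1 \<le> l" "l < n" for l
      using cases[of l] edge[OF that] Cj i unfolding P_def by auto
    then show "vertex_cover {1..n} (path_edges n) P"
      unfolding path_vertex_cover_iff using sub by (auto simp: P_def)
    have "l \<in> Q \<or> l + 1 \<in> Q" if "1 \<le> l" "l < n" for l
      using cases[of l] edge[OF that] k_prev i unfolding Q_def by auto
    then show "vertex_cover {1..n} (path_edges n) Q"
      unfolding path_vertex_cover_iff using sub by (auto simp: Q_def)
    show "{} \<subseteq> {1..n}" by simp
    show "cover_mon {} + cover_mon P + cover_mon Q = cover_mon (C j) + cover_mon (C k)"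
      by (rule cover_mon_sum_eqI)
        (use fin C_finite j k in \<open>auto simp: P_def Q_def\<close>)
    show "min j k < p" if p: "p \<in> {1..s}" "C p \<subseteq> P" for p
    proof -
      have "cover_mon (C p) <\<^sub>l\<^sub>e\<^sub>x cover_mon (C j)"
        by (rule cover_mon_lex_lessI[of _ _ i])
          (use p Cj Ck C_finite j in \<open>auto simp: P_def\<close>)
      then show ?thesis
        using index_less_iff[OF j p(1)] by simp
    qed
    show "min j k < q" if q: "q \<in> {1..s}" "C q \<subseteq> Q" for q
    proof -
      have "cover_mon (C q) <\<^sub>l\<^sub>e\<^sub>x cover_mon (C j)"
        by (rule cover_mon_lex_lessI[of _ _ a])
          (use q a \<open>a \<le> i - 3\<close> i C_finite j in \<open>auto simp: Q_def\<close>)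
      then show ?thesis
        using index_less_iff[OF j q(1)] by simp
    qed
  qed
qed

lemma AB_set_reduces:
  assumes "a \<in> A_set n s u \<union> B_set n s u"
  shows "\<exists>a'\<in>monomials (T_vars n s). mon_image u a' = mon_image u a \<and> a' <\<^sub>l\<^sub>e\<^sub>x a"
proof (cases "a \<in> A_set n s u")
  case True
  then show ?thesis by (rule A_set_reduces)
next
  case False
  then obtain j k where a: "a = y_mon j + y_mon k" and jk: "j < k" "B_pair j k"
    and j: "j \<in> {1..s}" and k: "k \<in> {1..s}"
    using assms by (auto simp: B_set_eq)
  from jk(2) consider
      (unsorted) i where "3 \<le> i" "i \<le> n - 1" "i - 1 \<in> C j" "i \<in> C j" "i - 2 \<notin> C k" "i \<notin> C k"
        "C j \<inter> {1..i - 3} \<noteq> C k \<inter> {1..i - 3}"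
    | (right) i where "3 \<le> i" "i \<in> C j" "i + 1 \<in> C j" "i - 1 \<in> C k" "i \<in> C k"
    | (left) i where "3 \<le> i" "i - 1 \<in> C j" "i \<in> C j" "i \<in> C k" "i + 1 \<in> C k"
    unfolding B_pair_def by blast
  then show ?thesis
  proof cases
    case unsorted
    then show ?thesis
      unfolding a by (intro unsorted_pair_reduces[OF j k jk(1)]) auto
  next
    case right
    then show ?thesis
      unfolding a by (intro overlapping_pairs_reduce[OF j k, of i]) auto
  next
    case left
    then show ?thesis
      unfolding a add.commute[of "y_mon j"] by (intro overlapping_pairs_reduce[OF k j, of i]) auto
  qed
qed


section \<open>Standard monomials\<close>

definition standard :: "monom \<Rightarrow> bool" where
  "standard w \<longleftrightarrow>
     w \<in> monomials (T_vars n s) \<and> (\<forall>a\<in>A_set n s u \<union> B_set n s u. \<not> a dvd\<^sub>m w)"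

abbreviation y_exp :: "monom \<Rightarrow> nat \<Rightarrow> nat" where
  "y_exp w j \<equiv> Poly_Mapping.lookup w (YVar j)"

lemma standard_no_A:
  assumes w: "standard w" and i: "1 \<le> i" "i < n" and j: "j \<in> {1..s}" "0 < y_exp w j"
    and C: "i \<in> C j" "i = 1 \<or> i - 1 \<in> C j"
  shows "Poly_Mapping.lookup w (XVar (i + 1)) = 0"
proof (rule ccontr)
  assume "Poly_Mapping.lookup w (XVar (i + 1)) \<noteq> 0"
  then have "(x_mon (i + 1) + y_mon j) dvd\<^sub>m w"
    unfolding mon_dvd_iff_lookup_le using j by (auto simp: lookup_add lookup_single when_def)
  moreover have "x_mon (i + 1) + y_mon j \<in> A_set n s u"
    unfolding A_set_eq using i j C by blast
  ultimately show False
    using w unfolding standard_def by blast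
qed

lemma standard_no_B:
  assumes w: "standard w" and jk: "j \<in> {1..s}" "k \<in> {1..s}" "j < k"
    and "0 < y_exp w j" "0 < y_exp w k"
  shows "\<not> B_pair j k"
proof
  assume "B_pair j k"
  then have "y_mon j + y_mon k \<in> B_set n s u"
    unfolding B_set_eq using jk by auto
  moreover have "(y_mon j + y_mon k) dvd\<^sub>m w"
    unfolding mon_dvd_iff_lookup_le using assms by (auto simp: lookup_add lookup_single when_def)
  ultimately show False
    using w unfolding standard_def by blast
qed

section \<open>Counting the covers that contain a vertex\<close>

text \<open>
  The number of factors \<open>y\<^sub>j\<close> of \<open>w\<close> whose cover contains \<open>i\<close>. Every cover is counted as containing
  the auxiliary vertex \<open>0\<close>, so that \<open>cover_count w 0\<close> is the degree of \<open>w\<close> in the \<open>y\<close> variables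
  and vertex \<open>1\<close> needs no special treatment.
\<close>

definition cover_count :: "monom \<Rightarrow> nat \<Rightarrow> nat" where
  "cover_count w i = (\<Sum>j\<in>{1..s}. y_exp w j * of_bool (i = 0 \<or> i \<in> C j))"

text \<open>
  The image of a monomial records its degree in the \<open>y\<close> variables and, for each vertex, the sum of
  its \<open>x\<close> exponent and its cover count. In particular it bounds every exponent, so fibres are finite.
\<close>

lemma lookup_mon_image_T:
  assumes "w \<in> monomials (T_vars n s)"
  shows "1 \<le> i \<Longrightarrow> Poly_Mapping.lookup (mon_image u w) (XVar i) =
      Poly_Mapping.lookup w (XVar i) + cover_count w i"
    and "Poly_Mapping.lookup (mon_image u w) TVar = cover_count w 0"
proof -
  have split: "Poly_Mapping.lookup (mon_image u w) v =
      (\<Sum>k\<in>{1..n}. Poly_Mapping.lookup w (XVar k) * Poly_Mapping.lookup (x_mon k) v) +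
      (\<Sum>j\<in>{1..s}. y_exp w j * Poly_Mapping.lookup (u j + t_mon) v)" for v
  proof -
    have "XVar ` {1..n} \<inter> YVar ` {1..s} = {}" by auto
    then show ?thesis
      using assms by (subst lookup_mon_image[of "T_vars n s"])
        (simp_all add: T_vars_def sum.union_disjoint sum.reindex inj_on_def)
  qed
  have "(\<Sum>k\<in>{1..n}. Poly_Mapping.lookup w (XVar k) * Poly_Mapping.lookup (x_mon k) (XVar i)) =
      Poly_Mapping.lookup w (XVar i)"
  proof -
    have "(\<Sum>k\<in>{1..n}. Poly_Mapping.lookup w (XVar k) * Poly_Mapping.lookup (x_mon k) (XVar i)) =
        (\<Sum>k\<in>{1..n}. if k = i then Poly_Mapping.lookup w (XVar k) else 0)"
      by (rule sum.cong) (auto simp: lookup_single when_def)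
    moreover have "XVar i \<notin> Poly_Mapping.keys w" if "i \<notin> {1..n}"
      using assms that unfolding monomials_def T_vars_def by auto
    ultimately show ?thesis
      by (auto simp: in_keys_iff)
  qed
  moreover have "(\<Sum>j\<in>{1..s}. y_exp w j * Poly_Mapping.lookup (u j + t_mon) (XVar i)) =
      cover_count w i" if "1 \<le> i"
    unfolding cover_count_def
    by (rule sum.cong) (use that in \<open>auto simp: lookup_add lookup_single lookup_u_X\<close>)
  ultimately show "1 \<le> i \<Longrightarrow> Poly_Mapping.lookup (mon_image u w) (XVar i) =
      Poly_Mapping.lookup w (XVar i) + cover_count w i"
    using split by simp
  have "(\<Sum>j\<in>{1..s}. y_exp w j * Poly_Mapping.lookup (u j + t_mon) TVar) = cover_count w 0"
    unfolding cover_count_def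
    by (rule sum.cong) (auto simp: lookup_add lookup_cover_mon_other u_eq)
  then show "Poly_Mapping.lookup (mon_image u w) TVar = cover_count w 0"
    using split[of TVar] by (simp add: lookup_single)
qed

lemma finite_fibre: "finite {w \<in> monomials (T_vars n s). mon_image u w = m}" (is "finite ?F")
proof -
  define N where "N = Poly_Mapping.lookup m TVar + (\<Sum>i\<in>{1..n}. Poly_Mapping.lookup m (XVar i))"
  have fin: "finite (T_vars n s)"
    by (simp add: T_vars_def)
  have "Poly_Mapping.lookup w v \<le> N" if w: "w \<in> ?F" and v: "v \<in> T_vars n s" for w v
  proof -
    have wT: "w \<in> monomials (T_vars n s)" and m: "m = mon_image u w"
      using w by auto
    consider (x) i where "v = XVar i" "i \<in> {1..n}" | (y) j where "v = YVar j" "j \<in> {1..s}"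
      using v unfolding T_vars_def by blast
    then show ?thesis
    proof cases
      case x
      have "Poly_Mapping.lookup w v \<le> Poly_Mapping.lookup m (XVar i)"
        using lookup_mon_image_T(1)[OF wT, of i] x by (simp add: m)
      also have "\<dots> \<le> (\<Sum>i\<in>{1..n}. Poly_Mapping.lookup m (XVar i))"
        by (rule member_le_sum) (use x in auto)
      finally show ?thesis by (simp add: N_def)
    next
      case y
      have "Poly_Mapping.lookup w v \<le> cover_count w 0"
        unfolding cover_count_def using y member_le_sum[of j "{1..s}" "y_exp w"] by simp
      then show ?thesis
        using lookup_mon_image_T(2)[OF wT] by (simp add: N_def m)
    qed
  qed
  moreover have "Poly_Mapping.lookup w v = 0" if "w \<in> ?F" "v \<notin> T_vars n s" for w v
    using that by (auto simp: monomials_def in_keys_iff)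
  ultimately have "Poly_Mapping.lookup ` ?F \<subseteq>
      {f. \<forall>v. (v \<in> T_vars n s \<longrightarrow> f v \<in> {..N}) \<and> (v \<notin> T_vars n s \<longrightarrow> f v = 0)}"
    by auto
  then have "finite (Poly_Mapping.lookup ` ?F)"
    using finite_set_of_finite_funs[OF fin, of "{..N}" 0] finite_subset by blast
  moreover have "inj_on Poly_Mapping.lookup ?F"
    by (rule inj_onI) (rule iffD2[OF poly_mapping_eq_iff])
  ultimately show ?thesis
    using finite_imageD by blast
qed

text \<open>
  A cover contains at least one end of the edge from \<open>i - 1\<close> to \<open>i\<close>. So the two counts together
  contain every cover once, and once more if both ends belong to it.
\<close>

lemma cover_count_pair:
  assumes i: "1 \<le> i" "i \<le> n"
  shows "cover_count w (i - 1) + cover_count w i =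
    cover_count w 0 + (\<Sum>j\<in>{1..s}. y_exp w j * of_bool (i \<in> C j \<and> (i = 1 \<or> i - 1 \<in> C j)))"
proof -
  have "of_bool (i - 1 = 0 \<or> i - 1 \<in> C j) + of_bool (i = 0 \<or> i \<in> C j) =
      (1 + of_bool (i \<in> C j \<and> (i = 1 \<or> i - 1 \<in> C j)) :: nat)" if "j \<in> {1..s}" for j
    using min_path_cover_edge[OF C_min[OF that], of "i - 1"] i by auto
  then show ?thesis
    unfolding cover_count_def sum.distrib[symmetric]
    by (intro sum.cong) (simp_all flip: distrib_left)
qed

lemma weighted_count_nonzero:
  assumes "(\<Sum>j\<in>S. f j * of_bool (Q j)) \<noteq> (0 :: nat)"
  shows "\<exists>j\<in>S. 0 < f j \<and> Q j"
proof (rule ccontr)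
  assume "\<not> ?thesis"
  then have "(\<Sum>j\<in>S. f j * of_bool (Q j)) = 0"
    by (intro sum.neutral) auto
  then show False using assms by contradiction
qed

lemma cover_count_pair_pos:
  assumes i: "1 \<le> i" "i \<le> n" and pos: "cover_count w 0 < cover_count w (i - 1) + cover_count w i"
  obtains j where "j \<in> {1..s}" "0 < y_exp w j" "i \<in> C j" "i = 1 \<or> i - 1 \<in> C j"
proof -
  have "(\<Sum>j\<in>{1..s}. y_exp w j * of_bool (i \<in> C j \<and> (i = 1 \<or> i - 1 \<in> C j))) \<noteq> 0"
    using cover_count_pair[OF i, of w] pos by linarith
  from weighted_count_nonzero[OF this] show thesis
    using that by blast
qed

text \<open>
  If \<open>w\<close> had the larger count at \<open>i\<close>, it would have a cover containing \<open>i - 1\<close> and \<open>i\<close>. Then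
  \<open>\<A>\<^sub>n\<close> forces the exponent of \<open>x\<^sub>i\<^sub>+\<^sub>1\<close> to be zero, so that the count at \<open>i + 1\<close> is the largest
  possible for this image. Two consecutive large counts force a cover that contains \<open>i\<close> and
  \<open>i + 1\<close>, and together with the first cover this is forbidden by \<open>\<B>\<^sub>n\<close>.
\<close>

lemma cover_count_le_step:
  assumes w: "standard w" and w': "w' \<in> monomials (T_vars n s)"
    and img: "mon_image u w = mon_image u w'" and i: "1 \<le> i" "i \<le> n"
    and prev: "cover_count w (i - 1) = cover_count w' (i - 1)"
  shows "cover_count w i \<le> cover_count w' i"
proof (rule ccontr)
  assume "\<not> ?thesis"
  then have more: "cover_count w' i < cover_count w i" by simp
  have wT: "w \<in> monomials (T_vars n s)"
    using w by (simp add: standard_def)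
  have deg: "cover_count w 0 = cover_count w' 0"
    using lookup_mon_image_T(2)[OF wT] lookup_mon_image_T(2)[OF w'] img by simp
  have "cover_count w 0 < cover_count w (i - 1) + cover_count w i"
    using cover_count_pair[OF i, of w'] more prev deg by linarith
  then obtain j where j: "j \<in> {1..s}" "0 < y_exp w j" "i \<in> C j" "i = 1 \<or> i - 1 \<in> C j"
    using cover_count_pair_pos[OF i] by blast
  have "i < n"
    using min_path_cover_pair_less[OF C_min[OF j(1)] j(3,4)] ..
  have "Poly_Mapping.lookup w (XVar (i + 1)) = 0"
    by (rule standard_no_A[OF w i(1) \<open>i < n\<close> j])
  then have "cover_count w' (i + 1) \<le> cover_count w (i + 1)"
    using lookup_mon_image_T(1)[OF wT, of "i + 1"] lookup_mon_image_T(1)[OF w', of "i + 1"] img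
    by simp
  moreover have "cover_count w' 0 \<le> cover_count w' i + cover_count w' (i + 1)"
    using cover_count_pair[of "i + 1" w'] \<open>i < n\<close> by simp
  ultimately have "cover_count w 0 < cover_count w (i + 1 - 1) + cover_count w (i + 1)"
    using more deg by simp
  then obtain k where k: "k \<in> {1..s}" "0 < y_exp w k" "i + 1 \<in> C k" "i \<in> C k"
    using cover_count_pair_pos[of "i + 1" w] \<open>i < n\<close> i by auto
  \<comment> \<open>The covers \<open>C j\<close> and \<open>C k\<close> overlap in \<open>i\<close>; minimality keeps \<open>i\<close> away from the ends.\<close>
  have next_less: "i + 1 < n"
    using min_path_cover_pair_less[OF C_min[OF k(1)] k(3)] k(4) by simp
  have "i \<noteq> 1 \<and> i - 1 \<notin> C k"
    using min_path_cover_pair_less[OF C_min[OF k(1)] k(4)] k(3) by blast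
  moreover have "i - 1 \<noteq> 1"
    using min_path_cover_pair_less[OF C_min[OF j(1)], of "i - 1"] j(3,4) i by auto
  ultimately have i3: "3 \<le> i" and j_prev: "i - 1 \<in> C j"
    using i j(4) by auto
  have "j \<noteq> k"
    using \<open>i \<noteq> 1 \<and> i - 1 \<notin> C k\<close> j_prev by blast
  moreover have "B_pair j k"
    unfolding B_pair_def
    by (rule disjI2, rule disjI2, rule exI[of _ i]) (use i3 j(3) j_prev k(3,4) next_less in auto)
  moreover have "B_pair k j"
    unfolding B_pair_def
    by (rule disjI2, rule disjI1, rule exI[of _ i]) (use i3 j(3) j_prev k(3,4) next_less in auto)
  ultimately show False
    using standard_no_B[OF w] j(1,2) k(1,2) by (metis linorder_neqE_nat)
qed

lemma cover_count_determined:
  assumes w: "standard w" "standard w'" and img: "mon_image u w = mon_image u w'" and i: "i \<le> n"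
  shows "cover_count w i = cover_count w' i"
  using i
proof (induction i)
  case 0
  then show ?case
    using lookup_mon_image_T(2)[of w] lookup_mon_image_T(2)[of w'] w img by (simp add: standard_def)
next
  case (Suc i)
  then show ?case
    using cover_count_le_step[of w w' "Suc i"] cover_count_le_step[of w' w "Suc i"] w img
    by (simp add: standard_def)
qed

section \<open>Recovering the covers from their counts\<close>

text \<open>
  Reading covers from left to right, \<open>prefix_count w i\<close> is the multiset of the prefixes on
  \<open>{1..i}\<close> of the covers in \<open>w\<close>, as a multiplicity function; \<open>extend_count\<close> keeps only the covers
  that continue with the vertex \<open>i + 1\<close>.
\<close>

definition prefix_count :: "monom \<Rightarrow> nat \<Rightarrow> nat set \<Rightarrow> nat" where
  "prefix_count w i p = (\<Sum>j\<in>{1..s}. y_exp w j * of_bool (C j \<inter> {1..i} = p))"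

definition extend_count :: "monom \<Rightarrow> nat \<Rightarrow> nat set \<Rightarrow> nat" where
  "extend_count w i p = (\<Sum>j\<in>{1..s}. y_exp w j * of_bool (C j \<inter> {1..i} = p \<and> i + 1 \<in> C j))"

lemma prefix_count_split:
  "prefix_count w i p = extend_count w i p +
     (\<Sum>j\<in>{1..s}. y_exp w j * of_bool (C j \<inter> {1..i} = p \<and> i + 1 \<notin> C j))"
  unfolding prefix_count_def extend_count_def sum.distrib[symmetric]
  by (intro sum.cong) auto

lemma prefix_count_Suc:
  "prefix_count w (i + 1) p =
     (if i + 1 \<in> p then extend_count w i (p - {i + 1}) else prefix_count w i p - extend_count w i p)"
proof -
  have "{1..i + 1} = insert (i + 1) {1..i}" by auto
  then have "C j \<inter> {1..i + 1} = p \<longleftrightarrow>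
      C j \<inter> {1..i} = p - {i + 1} \<and> (i + 1 \<in> C j \<longleftrightarrow> i + 1 \<in> p)" for j
    by auto
  then show ?thesis
    using prefix_count_split[of w i p] unfolding prefix_count_def[of w "i + 1"] extend_count_def
    by simp
qed

lemma sum_extend_count: "(\<Sum>p\<in>Pow {1..i}. extend_count w i p) = cover_count w (i + 1)"
proof -
  have "(\<Sum>p\<in>Pow {1..i}. of_bool (C j \<inter> {1..i} = p \<and> i + 1 \<in> C j)) =
      (of_bool (i + 1 \<in> C j) :: nat)" for j
    by (simp add: of_bool_conj)
  then show ?thesis
    unfolding extend_count_def cover_count_def
    by (subst sum.swap) (simp flip: sum_distrib_left)
qed

text \<open>
  If a prefix with the same multiplicity in \<open>w\<close> and \<open>w'\<close> is extended more often in \<open>w\<close>, then it is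
  extended at least once in \<open>w\<close> and left unextended at least once in \<open>w'\<close>.
\<close>

lemma extend_count_lessE:
  assumes "extend_count w' i p < extend_count w i p" "prefix_count w i p = prefix_count w' i p"
  obtains j k where "j \<in> {1..s}" "0 < y_exp w j" "C j \<inter> {1..i} = p" "i + 1 \<in> C j"
    "k \<in> {1..s}" "0 < y_exp w' k" "C k \<inter> {1..i} = p" "i + 1 \<notin> C k"
proof -
  have "(\<Sum>j\<in>{1..s}. y_exp w j * of_bool (C j \<inter> {1..i} = p \<and> i + 1 \<in> C j)) \<noteq> 0"
    using assms(1) unfolding extend_count_def by linarith
  from weighted_count_nonzero[OF this]
  obtain j where j: "j \<in> {1..s}" "0 < y_exp w j" "C j \<inter> {1..i} = p" "i + 1 \<in> C j"
    by blast
  have "(\<Sum>j\<in>{1..s}. y_exp w' j * of_bool (C j \<inter> {1..i} = p \<and> i + 1 \<notin> C j)) \<noteq> 0"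
    using assms prefix_count_split[of w i p] prefix_count_split[of w' i p] by linarith
  from weighted_count_nonzero[OF this]
  obtain k where k: "k \<in> {1..s}" "0 < y_exp w' k" "C k \<inter> {1..i} = p" "i + 1 \<notin> C k"
    by blast
  show thesis
    by (rule that[OF j k])
qed

lemma mem_prefix_iff:
  assumes "j \<in> {1..s}" "C j \<inter> {1..i} = p" "l \<le> i"
  shows "l \<in> C j \<longleftrightarrow> l \<in> p"
  unfolding assms(2)[symmetric] using assms(3) zero_notin_C[OF assms(1)] by (cases "l = 0") auto

text \<open>
  Let both \<open>p\<close> and \<open>q\<close> be prefixes of covers with and without \<open>i + 1\<close>. They then contain \<open>i\<close> and
  not \<open>i - 1\<close>, so they differ on \<open>{1..i - 2}\<close>. If a standard monomial extends \<open>p\<close> by \<open>i + 1\<close> and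
  leaves \<open>q\<close> unextended, then \<open>p\<close> is lexicographically smaller than \<open>q\<close>, since otherwise the two
  covers would satisfy the first condition in \<open>\<B>\<^sub>n\<close>. The covers \<open>C j'\<close> and \<open>C k'\<close> need not belong
  to this monomial; they only show that both continuations exist.
\<close>

lemma standard_extensions_sorted:
  assumes w: "standard w" and i: "i < n" and pq: "p \<noteq> q"
    and j: "j \<in> {1..s}" "0 < y_exp w j" "C j \<inter> {1..i} = p" "i + 1 \<in> C j"
    and k: "k \<in> {1..s}" "0 < y_exp w k" "C k \<inter> {1..i} = q" "i + 1 \<notin> C k"
    and j': "j' \<in> {1..s}" "C j' \<inter> {1..i} = p" "i + 1 \<notin> C j'"
    and k': "k' \<in> {1..s}" "C k' \<inter> {1..i} = q" "i + 1 \<in> C k'"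
  obtains a where "a \<in> q" "a \<notin> p" "\<And>l. l < a \<Longrightarrow> l \<in> p \<longleftrightarrow> l \<in> q"
proof -
  have "1 \<le> i"
    using pq j(3) k(3) by (cases i) auto
  note in_iff = mem_prefix_iff[OF j(1,3)] mem_prefix_iff[OF k(1,3)]
    mem_prefix_iff[OF j'(1,2)] mem_prefix_iff[OF k'(1,2)]
  have i_p: "i \<in> p" and i_q: "i \<in> q"
    using min_path_cover_edge[OF C_min[OF j'(1)] \<open>1 \<le> i\<close> i]
      min_path_cover_edge[OF C_min[OF k(1)] \<open>1 \<le> i\<close> i] j'(3) k(4) in_iff[of i] by auto
  have "i \<noteq> 1 \<and> i - 1 \<notin> C j" "i \<noteq> 1 \<and> i - 1 \<notin> C k'"
    using min_path_cover_pair_less[OF C_min[OF j(1)], of i]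
      min_path_cover_pair_less[OF C_min[OF k'(1)], of i] i_p i_q in_iff[of i] j(4) k'(3) by auto
  then have "2 \<le> i" and prev: "i - 1 \<notin> p" "i - 1 \<notin> q"
    using \<open>1 \<le> i\<close> in_iff[of "i - 1"] by auto
  have "i + 1 < n"
    using min_path_cover_pair_less[OF C_min[OF j(1)] j(4)] i_p in_iff[of i] by auto
  \<comment> \<open>The prefixes agree on \<open>i - 1\<close> and \<open>i\<close>.\<close>
  have "C j \<inter> {1..i - 2} \<noteq> C k \<inter> {1..i - 2}"
  proof
    assume same: "C j \<inter> {1..i - 2} = C k \<inter> {1..i - 2}"
    have range: "{1..i} = insert i (insert (i - 1) {1..i - 2})"
      using \<open>2 \<le> i\<close> by auto
    have "C j \<inter> {1..i} = insert i (C j \<inter> {1..i - 2})" "C k \<inter> {1..i} = insert i (C k \<inter> {1..i - 2})"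
      unfolding range using i_p i_q prev in_iff[of i] in_iff[of "i - 1"]
      by (simp_all add: Int_insert_right)
    then have "p = q"
      using same j(3) k(3) by simp
    then show False using pq by blast
  qed
  then have "B_pair j k"
    unfolding B_pair_def
    by (intro disjI1 exI[of _ "i + 1"])
      (use \<open>2 \<le> i\<close> \<open>i + 1 < n\<close> i_p prev j(4) k(4) in_iff[of i] in_iff[of "i - 1"] in
        \<open>auto simp: numeral_2_eq_2 numeral_3_eq_3\<close>)
  then have "\<not> j < k"
    using standard_no_B[OF w j(1) k(1)] j(2) k(2) by blast
  moreover have "j \<noteq> k"
    using j(4) k(4) by blast
  ultimately have "k < j" by simp
  then obtain a where a: "a \<in> C k" "a \<notin> C j" "\<And>l. l < a \<Longrightarrow> l \<in> C j \<longleftrightarrow> l \<in> C k"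
    using cover_mon_lex_lessE[OF C_finite[OF k(1)] C_finite[OF j(1)]]
      index_less_iff[OF k(1) j(1)] by metis
  have "a \<le> i"
  proof (rule ccontr)
    assume "\<not> a \<le> i"
    then have "C j \<inter> {1..i} = C k \<inter> {1..i}"
      using a(3) by auto
    then show False using pq j(3) k(3) by blast
  qed
  show thesis
    by (rule that[of a]) (use a \<open>a \<le> i\<close> in_iff in auto)
qed

lemma sum_eq_imp_less_and_greater:
  fixes f g :: "'a \<Rightarrow> nat"
  assumes "finite S" "sum f S = sum g S" "x \<in> S" "f x \<noteq> g x"
  shows "\<exists>p\<in>S. \<exists>q\<in>S. g p < f p \<and> f q < g q"
proof -
  have "\<exists>p\<in>S. g p < f p" if "x \<in> S" "f x \<noteq> g x" "sum f S = sum g S" for f g :: "'a \<Rightarrow> nat"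
  proof (rule ccontr)
    assume "\<not> ?thesis"
    then have "\<forall>p\<in>S. f p \<le> g p" by (simp add: not_less)
    moreover have "f x < g x" using calculation that by (simp add: order_less_le)
    ultimately have "sum f S < sum g S"
      using sum_strict_mono_ex1[OF assms(1)] that(1) by blast
    then show False using that(3) by simp
  qed
  from this[of f g] this[of g f] show ?thesis
    using assms by metis
qed

text \<open>
  The total number of extended prefixes is prescribed. If \<open>w\<close> extended some \<open>p\<close> more often than
  \<open>w'\<close>, it would extend some \<open>q\<close> less often, and sortedness of \<open>w\<close> and of \<open>w'\<close> would give
  \<open>p < q\<close> and \<open>q < p\<close>.
\<close>

lemma extend_count_determined:
  assumes w: "standard w" "standard w'" and i: "i < n"
    and prefix: "\<And>p. prefix_count w i p = prefix_count w' i p"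
    and count: "cover_count w (i + 1) = cover_count w' (i + 1)"
  shows "extend_count w i p = extend_count w' i p"
proof (rule ccontr)
  assume ne: "extend_count w i p \<noteq> extend_count w' i p"
  have "p \<in> Pow {1..i}"
  proof (rule ccontr)
    assume "p \<notin> Pow {1..i}"
    then have "C j \<inter> {1..i} \<noteq> p" for j by blast
    then show False
      using ne by (simp add: extend_count_def)
  qed
  then obtain p q where p: "extend_count w' i p < extend_count w i p"
    and q: "extend_count w i q < extend_count w' i q"
    using sum_eq_imp_less_and_greater[of "Pow {1..i}" "extend_count w i" "extend_count w' i" p]
      sum_extend_count[of w i] sum_extend_count[of w' i] count ne by auto
  obtain j j' where j: "j \<in> {1..s}" "0 < y_exp w j" "C j \<inter> {1..i} = p" "i + 1 \<in> C j"
    and j': "j' \<in> {1..s}" "0 < y_exp w' j'" "C j' \<inter> {1..i} = p" "i + 1 \<notin> C j'"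
    using extend_count_lessE[OF p prefix] by blast
  obtain k' k where k': "k' \<in> {1..s}" "0 < y_exp w' k'" "C k' \<inter> {1..i} = q" "i + 1 \<in> C k'"
    and k: "k \<in> {1..s}" "0 < y_exp w k" "C k \<inter> {1..i} = q" "i + 1 \<notin> C k"
    using extend_count_lessE[OF q prefix[symmetric]] by blast
  have "p \<noteq> q" using p q by auto
  obtain a where a: "a \<in> q" "a \<notin> p" "\<And>l. l < a \<Longrightarrow> l \<in> p \<longleftrightarrow> l \<in> q"
    using standard_extensions_sorted[OF w(1) i \<open>p \<noteq> q\<close> j k j'(1,3,4) k'(1,3,4)] by blast
  obtain b where b: "b \<in> p" "b \<notin> q" "\<And>l. l < b \<Longrightarrow> l \<in> q \<longleftrightarrow> l \<in> p"
    using standard_extensions_sorted[OF w(2) i \<open>p \<noteq> q\<close>[symmetric] k' j' k(1,3,4) j(1,3,4)] by blast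
  show False
    using a b by (metis linorder_neqE_nat)
qed

lemma prefix_count_determined:
  assumes w: "standard w" "standard w'" and img: "mon_image u w = mon_image u w'" and i: "i \<le> n"
  shows "prefix_count w i p = prefix_count w' i p"
  using i
proof (induction i arbitrary: p)
  case 0
  then show ?case
    using cover_count_determined[OF w img, of 0]
    by (cases "p = {}") (auto simp: prefix_count_def cover_count_def)
next
  case (Suc i)
  have ext: "extend_count w i q = extend_count w' i q" for q
    by (rule extend_count_determined[OF w])
      (use Suc cover_count_determined[OF w img, of "i + 1"] in auto)
  then show ?case
    using prefix_count_Suc[of w i p] prefix_count_Suc[of w' i p] Suc by simp
qed

text \<open>
  Prefixes of length \<open>n\<close> are the covers themselves, so all \<open>y\<close> exponents agree; the \<open>x\<close> exponents
  agree because the cover counts do.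
\<close>

lemma standard_unique:
  assumes w: "standard w" "standard w'" and img: "mon_image u w = mon_image u w'"
  shows "w = w'"
proof (rule poly_mapping_eqI)
  fix v
  have T: "w \<in> monomials (T_vars n s)" "w' \<in> monomials (T_vars n s)"
    using w by (simp_all add: standard_def)
  have y_eq: "prefix_count w n (C j) = y_exp w j" if "j \<in> {1..s}" for w j
  proof -
    have "prefix_count w n (C j) = (\<Sum>k\<in>{1..s}. if k = j then y_exp w k else 0)"
      unfolding prefix_count_def
    proof (rule sum.cong)
      fix k assume k: "k \<in> {1..s}"
      have "C k \<inter> {1..n} = C k"
        using min_path_cover_subset[OF C_min[OF k]] by blast
      then show "y_exp w k * of_bool (C k \<inter> {1..n} = C j) = (if k = j then y_exp w k else 0)"
        using C_inj k that by (auto dest: inj_onD)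
    qed simp
    then show ?thesis using that by simp
  qed
  consider (x) i where "v = XVar i" "i \<in> {1..n}" | (y) j where "v = YVar j" "j \<in> {1..s}"
    | (none) "v \<notin> T_vars n s"
    unfolding T_vars_def by blast
  then show "Poly_Mapping.lookup w v = Poly_Mapping.lookup w' v"
  proof cases
    case x
    then show ?thesis
      using lookup_mon_image_T(1)[OF T(1), of i] lookup_mon_image_T(1)[OF T(2), of i] img
        cover_count_determined[OF w img, of i] by simp
  next
    case y
    then show ?thesis
      using prefix_count_determined[OF w img, of n "C j"] y_eq[OF y(2)]
      by simp
  next
    case none
    then have "v \<notin> Poly_Mapping.keys w" "v \<notin> Poly_Mapping.keys w'"
      using T by (auto simp: monomials_def)
    then show ?thesis
      by (simp add: in_keys_iff)
  qed
qed

section \<open>The initial ideal\<close>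

text \<open>
  The smallest monomial of a fibre is standard, since a divisor from \<open>\<A>\<^sub>n \<union> \<B>\<^sub>n\<close> could be replaced
  by a smaller monomial with the same image. A standard monomial is hence the smallest in its fibre.
\<close>

lemma not_least_in_fibre_imp_dvd:
  assumes w: "w \<in> monomials (T_vars n s)" and w': "w' \<in> monomials (T_vars n s)"
    and img: "mon_image u w' = mon_image u w" and less: "w' <\<^sub>l\<^sub>e\<^sub>x w"
  shows "\<exists>a\<in>A_set n s u \<union> B_set n s u. a dvd\<^sub>m w"
proof (rule ccontr)
  assume "\<not> ?thesis"
  then have std: "standard w"
    using w by (simp add: standard_def)
  let ?F = "{v \<in> monomials (T_vars n s). mon_image u v = mon_image u w}"
  obtain m where m: "m \<in> ?F" and least: "\<And>x. x \<in> ?F \<Longrightarrow> \<not> x <\<^sub>l\<^sub>e\<^sub>x m"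
    using finite_lex_minimal[OF finite_fibre] w by blast
  have "standard m"
    unfolding standard_def
  proof (intro conjI ballI notI)
    fix a assume a: "a \<in> A_set n s u \<union> B_set n s u" "a dvd\<^sub>m m"
    then obtain q where q: "m = a + q"
      by (auto simp: mon_dvd_def)
    obtain a' where a': "a' \<in> monomials (T_vars n s)" "mon_image u a' = mon_image u a" "a' <\<^sub>l\<^sub>e\<^sub>x a"
      using AB_set_reduces[OF a(1)] by blast
    then have "a' + q \<in> ?F"
      using m by (simp add: q mon_image_add monomials_add_iff)
    then show False
      using least lex_less_add_right[OF a'(3)] unfolding q by blast
  qed (use m in simp)
  then have "m = w"
    using standard_unique std m by simp
  then show False
    using least[of w'] w' img less by simp
qed

lemma initial_ideal_eq:
  "initial_ideal (T_vars n s) (rees_ideal n s u :: 'k::field mpoly set) =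
     Idl\<^bsub>poly_ring (T_vars n s)\<^esub> (poly_of_mon ` (A_set n s u \<union> B_set n s u))"
proof -
  define L where "L = {m. \<exists>p\<in>(rees_ideal n s u :: 'k mpoly set). is_initial_monomial p m}"
  have L: "m \<in> L \<longleftrightarrow> m \<in> monomials (T_vars n s) \<and>
      (\<exists>m'\<in>monomials (T_vars n s). mon_image u m' = mon_image u m \<and> m' <\<^sub>l\<^sub>e\<^sub>x m)" for m
    unfolding L_def using rees_initial_monomial_iff by simp
  have "A_set n s u \<union> B_set n s u \<subseteq> L"
    using AB_set_reduces AB_set_in_monomials unfolding L subset_iff by blast
  then have "Idl\<^bsub>poly_ring (T_vars n s)\<^esub> (poly_of_mon ` L) =
      (Idl\<^bsub>poly_ring (T_vars n s)\<^esub> (poly_of_mon ` (A_set n s u \<union> B_set n s u)) :: 'k mpoly set)"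
    using L AB_set_in_monomials not_least_in_fibre_imp_dvd mon_dvd_refl
    by (intro equalityI Idl_of_monomials_mono) blast+
  moreover have "{poly_of_mon m | m. \<exists>p\<in>(rees_ideal n s u :: 'k mpoly set). is_initial_monomial p m} =
      (poly_of_mon ` L :: 'k mpoly set)"
    unfolding L_def by blast
  ultimately show ?thesis
    unfolding initial_ideal_def by (simp only:)
qed

end


theorem theorem4p3:
  fixes n s :: nat and u :: "nat \<Rightarrow> monom"
  assumes "n > 0"
    and "is_minimal_monomial_generators (S_vars n)
           (vertex_cover_ideal n :: 'k::field mpoly set) (u ` {1..s})"
    and "\<And>i j. 1 \<le> i \<Longrightarrow> i < j \<Longrightarrow> j \<le> s \<Longrightarrow> u j <\<^sub>l\<^sub>e\<^sub>x u i"
  shows "let in_J = initial_ideal (T_vars n s) (rees_ideal n s u :: 'k mpoly set) in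
         (\<forall>G. is_minimal_monomial_generators (T_vars n s) in_J G
              \<longleftrightarrow> G = A_set n s u \<union> B_set n s u) \<and>
         (\<exists>Q. Q \<subseteq> monomials (T_vars n s) \<and> (\<forall>m\<in>Q. mon_degree m = 2) \<and>
              in_J = Idl\<^bsub>poly_ring (T_vars n s)\<^esub> (poly_of_mon ` Q))"
proof -
  have gens: "u ` {1..s} = cover_mon ` min_path_covers n"
    using generators_of_vertex_cover_ideal[OF assms(2)] .
  define C where "C = (\<lambda>j. SOME D. D \<in> min_path_covers n \<and> u j = cover_mon D)"
  have C: "C j \<in> min_path_covers n \<and> u j = cover_mon (C j)" if "j \<in> {1..s}" for j
  proof -
    have "u j \<in> cover_mon ` min_path_covers n"
      using gens that by blast
    then have "\<exists>D. D \<in> min_path_covers n \<and> u j = cover_mon D"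
      by blast
    then show ?thesis
      unfolding C_def by (rule someI_ex)
  qed
  interpret numbered_path_covers n s u C
  proof
    have "D \<in> C ` {1..s}" if D: "D \<in> min_path_covers n" for D
    proof -
      have "cover_mon D \<in> u ` {1..s}"
        unfolding gens using D by (rule imageI)
      then obtain j where j: "j \<in> {1..s}" "cover_mon D = u j"
        by blast
      then have "cover_mon D = cover_mon (C j)"
        using C by simp
      moreover have "finite (C j)"
        using C[OF j(1)] min_path_cover_finite by blast
      ultimately have "D = C j"
        using cover_mon_inject min_path_cover_finite[OF D] by blast
      then show ?thesis
        using j(1) by blast
    qed
    then show "C ` {1..s} = min_path_covers n"
      using C by blast
    show "u j = cover_mon (C j)" if "j \<in> {1..s}" for j
      using C that by blast
  qed (rule assms(3))
  have "\<forall>G. is_minimal_monomial_generators (T_vars n s)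
      (Idl\<^bsub>poly_ring (T_vars n s)\<^esub> (poly_of_mon ` (A_set n s u \<union> B_set n s u)) :: 'k mpoly set) G
      \<longleftrightarrow> G = A_set n s u \<union> B_set n s u"
    by (intro allI minimal_monomial_generators_iff AB_set_in_monomials)
      (simp add: mon_dvd_same_degree_imp_eq AB_set_degree del: Un_iff)
  then show ?thesis
    unfolding Let_def initial_ideal_eq using AB_set_in_monomials AB_set_degree by blast
qed

end
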